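(* For every integer $N\geq 1$, $\varepsilon_0(N,2)=N\cdot 4^{N-1}$.
   Context: Let $N\ge 1$. A gluing datum with $N$ edges and $2$ faces consists of a composition $(m_1,m_2)$ of $2N$ into two positive integers together with a fixed-point-free involution $\iota$ of $\{1,\dots,2N\}$. Let $\tau$ be the permutation with cycles $(1,2,\dots,m_1)$ and $(m_1+1,\dots,2N)$. The datum is connected if $\langle\iota,\tau\rangle$ acts transitively on $\{1,\dots,2N\}$, and has genus $0$ if $\tau\iota$ has exactly $N$ cycles. (Geometrically: gluings of two numbered polygons with distinguished edges, having $2N$ edges in total, into a sphere, by pairing edges and gluing paired edges with opposite orientations; equivalently rooted planar maps with $N$ edges and two numbered faces each with a marked arc.) $\varepsilon_0(N,2)$ is the number of connected genus-$0$ such data. *)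

theory Defs
  imports "HOL-Algebra.Sym_Groups" "HOL-Combinatorics.Orbits"
begin

definition face_perm :: "nat \<Rightarrow> nat \<Rightarrow> nat \<Rightarrow> nat" where
  "face_perm m1 m2 = cycle_of_list [1..<Suc m1] \<circ> cycle_of_list [Suc m1..<Suc (m1 + m2)]"

text \<open>
  Permutations of \<open>{1..n}\<close> are functions on \<^typ>\<open>nat\<close> that are the identity outside \<open>{1..n}\<close>,
  so that distinct functions below are distinct involutions of \<open>{1..n}\<close>.
\<close>
definition fpf_involution :: "nat \<Rightarrow> (nat \<Rightarrow> nat) \<Rightarrow> bool" where
  "fpf_involution n \<iota> \<longleftrightarrow> \<iota> permutes {1..n} \<and> \<iota> \<circ> \<iota> = id \<and> (\<forall>i\<in>{1..n}. \<iota> i \<noteq> i)"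

definition gluing_data :: "nat \<Rightarrow> (nat \<times> nat \<times> (nat \<Rightarrow> nat)) set" where
  "gluing_data N =
     {(m1, m2, \<iota>). 0 < m1 \<and> 0 < m2 \<and> m1 + m2 = 2 * N \<and> fpf_involution (2 * N) \<iota>}"

definition connected_datum :: "nat \<Rightarrow> nat \<times> nat \<times> (nat \<Rightarrow> nat) \<Rightarrow> bool" where
  "connected_datum N = (\<lambda>(m1, m2, \<iota>).
     \<forall>x\<in>{1..2 * N}. \<forall>y\<in>{1..2 * N}.
       \<exists>g\<in>generate (sym_group (2 * N)) {\<iota>, face_perm m1 m2}. g x = y)"

text \<open>Fixed points count as cycles: they are the singleton orbits.\<close>
definition num_cycles :: "nat \<Rightarrow> (nat \<Rightarrow> nat) \<Rightarrow> nat" where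
  "num_cycles n p = card (orbit p ` {1..n})"

text \<open>
  With \<open>N\<close> edges, two faces and the cycles of \<open>\<tau> \<circ> \<iota>\<close> as vertices, this is Euler's relation
  \<open>V - N + 2 = 2\<close>.
\<close>
definition genus0_datum :: "nat \<Rightarrow> nat \<times> nat \<times> (nat \<Rightarrow> nat) \<Rightarrow> bool" where
  "genus0_datum N = (\<lambda>(m1, m2, \<iota>). num_cycles (2 * N) (face_perm m1 m2 \<circ> \<iota>) = N)"

lemma finite_gluing_data: "finite (gluing_data N)"
proof (rule finite_subset)
  show "gluing_data N \<subseteq> {..2 * N} \<times> {..2 * N} \<times> {\<iota>. \<iota> permutes {1..2 * N}}"
    by (auto simp: gluing_data_def fpf_involution_def)
  show "finite ({..2 * N} \<times> {..2 * N} \<times> {\<iota>. \<iota> permutes {1..2 * N}})"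
    by (intro finite_cartesian_product finite_permutations) auto
qed

definition eps0_2 :: "nat \<Rightarrow> nat" where
  "eps0_2 N = card {d \<in> gluing_data N. connected_datum N d \<and> genus0_datum N d}"

end

theory Submission
  imports Defs "HOL-Computational_Algebra.Formal_Power_Series"
begin

text \<open>
  A connected genus-0 datum has \<open>N\<close> vertices and \<open>2 * N\<close> corners, so either \<open>\<tau> \<circ> \<iota>\<close> has a fixed point
  or all of its cycles have length 2. A fixed point is a pair of neighbouring corners of a face that are
  glued to each other; removing it leaves a connected genus-0 datum with one edge fewer. If all cycles
  have length 2, then \<open>\<iota>\<close> conjugates \<open>\<tau>\<close> to its inverse, so both faces have the same number \<open>k\<close> of
  corners and \<open>\<iota>\<close> is one of \<open>k\<close> rotations. Recording in every removal step the first corner of the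
  removed pair gives a set of ``opening'' corners that does not depend on the order of the removals. A
  set with \<open>i\<close> elements in the first face, which has \<open>p\<close> corners, and \<open>j\<close> in the second, which has
  \<open>q\<close>, arises from exactly \<open>k\<close> data if \<open>p - 2 * i = q - 2 * j = k > 0\<close>, and from none otherwise.

  With \<open>p + q = 2 * N\<close> the number of data is thus the sum of
  \<open>(p - 2 * i) * (p choose i) * (q choose (N - i))\<close> over \<open>2 * i < p\<close>. This sum telescopes, and the
  remaining sum over \<open>p\<close> is a convolution of coefficients of \<open>(1 - 4 x) powr (-3/2)\<close>.
\<close>

section \<open>Removing corners from a permutation\<close>

lemma orbit_two:
  assumes "f (f z) = z"
  shows "orbit f z = {z, f z}"
proof -
  have "orbit f z = (\<lambda>m. (f ^^ m) z) ` {..<2}"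
    using assms by (subst orbit_altdef_bounded[of 2]) (auto simp: numeral_2_eq_2)
  then show ?thesis by (simp add: numeral_2_eq_2 lessThan_Suc insert_commute)
qed

text \<open>Multiplication by this transposition cuts \<open>x\<close> out of its cycle:
  \<open>x\<close> becomes a fixed point and its predecessor is sent to \<open>f x\<close>. Written
  as a product, it inherits bijectivity from \<open>f\<close>.\<close>

definition skip :: "'a \<Rightarrow> ('a \<Rightarrow> 'a) \<Rightarrow> 'a \<Rightarrow> 'a" where
  "skip x f = transpose x (f x) \<circ> f"

lemma skip_apply:
  assumes "inj f"
  shows "skip x f z = (if z = x then x else if f z = x then f x else f z)"
  using injD[OF assms] by (auto simp: skip_def transpose_def)

lemma skip_permutes:
  assumes "f permutes S" "x \<in> S"
  shows "skip x f permutes (S - {x})"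
proof -
  have "f x \<in> S" using assms by (simp add: permutes_in_image)
  then have "skip x f permutes S"
    unfolding skip_def using assms by (intro permutes_compose permutes_swap_id)
  moreover have "skip x f x = x" by (simp add: skip_def)
  ultimately show ?thesis by (auto simp: permutes_def)
qed

lemma orbit_skip:
  assumes "inj f" "z \<noteq> x"
  shows "orbit (skip x f) z = orbit f z - {x}"
proof (intro equalityI subsetI)
  note [simp] = skip_apply[OF assms(1)]
  fix y assume "y \<in> orbit (skip x f) z"
  then show "y \<in> orbit f z - {x}"
  proof induction
    case base
    show ?case
    proof (cases "f z = x")
      case True
      then have "f x \<noteq> x" using assms injD by metis
      then show ?thesis using True assms orbit.step[OF orbit.base, of f z] by simp
    qed (use assms in \<open>auto intro: orbit.base\<close>)
  next
    case (step y)
    show ?case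
    proof (cases "f y = x")
      case True
      then have "f x \<noteq> x" using assms step injD by (metis DiffD2 singletonI)
      moreover have "f (f y) \<in> orbit f z" using step by (auto intro: orbit.step)
      ultimately show ?thesis using True step by auto
    qed (use step in \<open>auto intro: orbit.step\<close>)
  qed
next
  fix y assume "y \<in> orbit f z - {x}"
  then have y: "y \<in> orbit f z" and "y \<noteq> x" by auto
  \<comment> \<open>Where the \<open>f\<close>-orbit passes through \<open>x\<close>, the invariant
    records instead that the shortcut reaches \<open>f x\<close>. The disjunct
    \<open>f x = x\<close> lets the step at \<open>x\<close> go through without excluding a fixed
    point.\<close>
  from y have "if y = x then f x = x \<or> f x \<in> orbit (skip x f) z else y \<in> orbit (skip x f) z"
  proof (induction)
    case base
    then show ?case using orbit.base[of "skip x f" z] assms(2)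
      unfolding skip_apply[OF assms(1), of x z] by auto
  next
    case (step y)
    then show ?case using orbit.step[of y "skip x f" z]
      unfolding skip_apply[OF assms(1), of x y] by (cases "y = x"; cases "f y = x") auto
  qed
  then show "y \<in> orbit (skip x f) z" using \<open>y \<noteq> x\<close> by simp
qed

lemma cyclic_on_skip:
  assumes "inj f" "cyclic_on f A" "A - {x} \<noteq> {}"
  shows "cyclic_on (skip x f) (A - {x})"
  using assms by (auto simp: cyclic_on_alldef orbit_skip)

lemma orbit_eq_if_common:
  assumes "permutation f" "z \<in> orbit f x" "z \<in> orbit f y"
  shows "orbit f x = orbit f y"
  using assms orbit_cyclic_eq3[OF cyclic_on_orbit'[OF assms(1)]] by metis

text \<open>Since \<open>f x \<noteq> x\<close>, the orbit of \<open>x\<close> keeps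
  \<open>f x\<close>; deleting \<open>x\<close> from every orbit therefore neither empties an orbit
  nor merges two of them.\<close>

lemma card_orbits_skip:
  assumes f: "f permutes S" "finite S" and x: "x \<in> S" "f x \<noteq> x"
  shows "card (orbit (skip x f) ` (S - {x})) = card (orbit f ` S)"
proof -
  have perm: "permutation f" using f permutation_permutes by blast
  have inj: "inj f" using f(1) by (rule permutes_inj)
  have "orbit f ` S = orbit f ` (S - {x})"
  proof -
    have "orbit f x = orbit f (f x)" using perm by (simp add: permutation_orbit_step)
    moreover have "f x \<in> S - {x}" using f x by (simp add: permutes_in_image)
    ultimately show ?thesis by auto
  qed
  moreover have "orbit (skip x f) ` (S - {x}) = (\<lambda>X. X - {x}) ` (orbit f ` (S - {x}))"
    using inj by (auto simp: orbit_skip image_iff)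
  moreover have "inj_on (\<lambda>X. X - {x}) (orbit f ` (S - {x}))"
  proof (rule inj_onI)
    fix X Y assume "X \<in> orbit f ` (S - {x})" "Y \<in> orbit f ` (S - {x})" "X - {x} = Y - {x}"
    then obtain a b where X: "X = orbit f a" "Y = orbit f b" "a \<noteq> x" "orbit f a - {x} = orbit f b - {x}"
      by auto
    then have "a \<in> orbit f a" "a \<in> orbit f b"
      using permutation_self_in_orbit[OF perm] by blast+
    then show "X = Y" using orbit_eq_if_common[OF perm] X(1,2) by blast
  qed
  ultimately show ?thesis by (simp add: card_image)
qed

lemma card_orbits_remove_fixpoint:
  assumes f: "f permutes S" "finite S" and x: "x \<in> S" "f x = x"
  shows "card (orbit f ` S) = Suc (card (orbit f ` (S - {x})))"
proof -
  have perm: "permutation f" using f permutation_permutes by blast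
  have "orbit f x = {x}" using x by (simp add: orbit_eq_singleton_iff)
  moreover have "{x} \<notin> orbit f ` (S - {x})"
    using permutation_self_in_orbit[OF perm] by fastforce
  ultimately show ?thesis
    using insert_Diff[OF x(1)] \<open>finite S\<close>
    by (metis card_insert_disjoint finite_Diff finite_imageI image_insert)
qed

text \<open>
  Gluing the neighbouring corners \<open>x\<close> and \<open>\<tau> x\<close> of a face amounts to excising both of them from \<open>\<tau>\<close>.
\<close>
definition excise :: "'a \<Rightarrow> ('a \<Rightarrow> 'a) \<Rightarrow> 'a \<Rightarrow> 'a" where
  "excise x f = skip (f x) (skip x f)"

lemma inj_skip: "inj f \<Longrightarrow> inj (skip x f)"
  by (simp add: skip_def inj_compose)

lemma excise_apply:
  assumes "inj f" "f x \<noteq> x" "f (f x) \<noteq> x"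
  shows "excise x f z = (if z = x \<or> z = f x then z else if f z = x then f (f x) else f z)"
  using assms injD[OF assms(1)]
  by (auto simp: excise_def skip_apply[OF inj_skip] skip_apply)

section \<open>Abstract gluings of two faces and the removal of one edge\<close>

definition two_faces :: "'a set \<Rightarrow> 'a set \<Rightarrow> ('a \<Rightarrow> 'a) \<Rightarrow> bool" where
  "two_faces A B \<tau> \<longleftrightarrow> A \<inter> B = {} \<and> \<tau> permutes (A \<union> B) \<and> cyclic_on \<tau> A \<and> cyclic_on \<tau> B"

definition pairing :: "'a set \<Rightarrow> ('a \<Rightarrow> 'a) \<Rightarrow> bool" where
  "pairing S \<iota> \<longleftrightarrow> \<iota> permutes S \<and> (\<forall>x. \<iota> (\<iota> x) = x) \<and> (\<forall>x\<in>S. \<iota> x \<noteq> x)"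

text \<open>Arbitrary sets of corners replace intervals so that the notion survives removals.
  Connectedness becomes an edge shared by both faces, and genus 0 becomes one vertex per two
  corners.\<close>

definition annular :: "'a set \<Rightarrow> 'a set \<Rightarrow> ('a \<Rightarrow> 'a) \<Rightarrow> ('a \<Rightarrow> 'a) \<Rightarrow> bool" where
  "annular A B \<tau> \<iota> \<longleftrightarrow> pairing (A \<union> B) \<iota> \<and> (\<exists>x\<in>A. \<iota> x \<in> B) \<and>
     2 * card (orbit (\<tau> \<circ> \<iota>) ` (A \<union> B)) = card (A \<union> B)"

lemma two_faces_commute: "two_faces A B \<tau> \<longleftrightarrow> two_faces B A \<tau>"
  by (auto simp: two_faces_def Un_commute)

lemma annular_commute: "annular A B \<tau> \<iota> \<longleftrightarrow> annular B A \<tau> \<iota>"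
proof -
  have "annular B A \<tau> \<iota>" if "annular A B \<tau> \<iota>" for A B
    using that unfolding annular_def pairing_def by (auto simp: Un_commute) metis
  then show ?thesis by blast
qed

lemma two_faces_finite:
  assumes "two_faces A B \<tau>" shows "finite A" "finite B"
  using assms finite_cyclic_on by (auto simp: two_faces_def)

lemma two_faces_inj: "two_faces A B \<tau> \<Longrightarrow> inj \<tau>"
  by (auto simp: two_faces_def permutes_inj)

lemma two_faces_in:
  assumes "two_faces A B \<tau>"
  shows "\<tau> x \<in> A \<longleftrightarrow> x \<in> A" "\<tau> x \<in> B \<longleftrightarrow> x \<in> B"
  using assms cyclic_on_f_in cyclic_on_inI unfolding two_faces_def by metis+

lemma pairing_in: "pairing S \<iota> \<Longrightarrow> \<iota> x \<in> S \<longleftrightarrow> x \<in> S"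
  by (simp add: pairing_def permutes_in_image)

lemma two_faces_bigon:
  assumes "two_faces A B \<tau>" "x \<in> A" "\<tau> (\<tau> x) = x"
  shows "A = {x, \<tau> x}"
  using assms orbit_two[of \<tau> x] by (metis two_faces_def orbit_cyclic_eq3)

text \<open>A bigon with both sides glued to each other would be disconnected from the other face.\<close>
lemma annular_adjacent_pair:
  assumes "two_faces A B \<tau>" "annular A B \<tau> \<iota>" "x \<in> A \<union> B" "\<iota> x = \<tau> x"
  shows "\<tau> x \<noteq> x" "\<tau> (\<tau> x) \<noteq> x"
proof -
  show ne: "\<tau> x \<noteq> x" using assms by (auto simp: annular_def pairing_def)
  have *: False if tf: "two_faces A B \<tau>" and an: "annular A B \<tau> \<iota>" and "x \<in> A" "\<tau> (\<tau> x) = x" for A B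
  proof -
    have "A = {x, \<tau> x}" using two_faces_bigon that by metis
    moreover have "\<iota> (\<tau> x) = x" using an assms(4) by (metis annular_def pairing_def)
    ultimately show False using tf an assms(4) ne by (auto simp: annular_def two_faces_def)
  qed
  show "\<tau> (\<tau> x) \<noteq> x"
    using *[of A B] *[of B A] assms two_faces_commute annular_commute by blast
qed

lemma two_faces_excise:
  assumes tf: "two_faces A B \<tau>" and x: "x \<in> A \<union> B" "\<tau> x \<noteq> x" "\<tau> (\<tau> x) \<noteq> x"
  shows "two_faces (A - {x, \<tau> x}) (B - {x, \<tau> x}) (excise x \<tau>)"
proof -
  have inj: "inj \<tau>" using tf by (rule two_faces_inj)
  have third: "\<tau> (\<tau> x) \<noteq> \<tau> x" using x(2) injD[OF inj] by metis
  have cyc: "cyclic_on (excise x \<tau>) (C - {x, \<tau> x})" if C: "cyclic_on \<tau> C" for C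
  proof -
    \<comment> \<open>In the face that loses the pair, the third corner
      \<open>\<tau> (\<tau> x)\<close> survives, so the face does not become empty.\<close>
    have "\<tau> (\<tau> x) \<in> C" if "x \<in> C" using that C cyclic_on_inI by metis
    moreover have "\<tau> (\<tau> x) \<in> C" if "\<tau> x \<in> C" using that C cyclic_on_inI by metis
    moreover have "C \<noteq> {}" using C by (auto simp: cyclic_on_def)
    ultimately have "C - {x} - {\<tau> x} \<noteq> {}" using x third by blast
    then have "cyclic_on (excise x \<tau>) (C - {x} - {\<tau> x})"
      unfolding excise_def using C inj by (intro cyclic_on_skip inj_skip) auto
    then show ?thesis by (simp add: Diff_insert2[symmetric] insert_commute)
  qed
  have "excise x \<tau> permutes (A \<union> B - {x} - {\<tau> x})"
    unfolding excise_def using tf x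
two_faces_in[OF tf]
    by (intro skip_permutes) (auto simp: two_faces_def)
  moreover have "A \<union> B - {x} - {\<tau> x} = (A - {x, \<tau> x}) \<union> (B - {x, \<tau> x})" by auto
  ultimately show ?thesis using tf cyc unfolding two_faces_def by auto
qed

text \<open>The transposition is its own inverse: it deletes the arc between \<open>x\<close> and
  \<open>y\<close> by fixing both ends, and it reinserts the arc in the same way.\<close>

lemma pairing_skip:
  assumes "y \<in> S" "x \<in> S" "x \<noteq> y"
  shows "pairing S \<iota> \<and> \<iota> x = y \<longleftrightarrow> pairing (S - {x, y}) (transpose x y \<circ> \<iota>)"
proof
  assume L: "pairing S \<iota> \<and> \<iota> x = y"
  then have inv: "\<And>z. \<iota> (\<iota> z) = z" and y: "\<iota> y = x" by (auto simp: pairing_def)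
  have "transpose x y \<circ> \<iota> permutes S"
    using L assms by (intro permutes_compose permutes_swap_id) (auto simp: pairing_def)
  then have "transpose x y \<circ> \<iota> permutes (S - {x, y})"
    using L y by (auto simp: permutes_def)
  moreover have ix: "\<iota> z = x \<longleftrightarrow> z = y" "\<iota> z = y \<longleftrightarrow> z = x" for z using L y inv by metis+
  then have "(transpose x y \<circ> \<iota>) z = (if z = x \<or> z = y then z else \<iota> z)" for z
    by (auto simp: transpose_def)
  ultimately show "pairing (S - {x, y}) (transpose x y \<circ> \<iota>)"
    using L inv ix unfolding pairing_def by simp
next
  assume R: "pairing (S - {x, y}) (transpose x y \<circ> \<iota>)"
  define \<kappa> where "\<kappa> = transpose x y \<circ> \<iota>"
  have \<iota>: "\<iota> = transpose x y \<circ> \<kappa>" by (simp add: \<kappa>_def comp_assoc[symmetric])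
  have k: "pairing (S - {x, y}) \<kappa>" using R by (simp add: \<kappa>_def)
  have kx: "\<kappa> x = x" "\<kappa> y = y" using k by (auto simp: pairing_def permutes_def)
  have inv: "\<And>z. \<kappa> (\<kappa> z) = z" using k by (auto simp: pairing_def)
  then have \<kappa>ne: "\<kappa> z = x \<longleftrightarrow> z = x" "\<kappa> z = y \<longleftrightarrow> z = y" for z using kx by metis+
  then have ap: "\<iota> z = (if z = x then y else if z = y then x else \<kappa> z)" for z
    by (auto simp: \<iota> transpose_def)
  have "\<kappa> permutes S" using k by (auto simp: pairing_def intro: permutes_subset)
  then have "\<iota> permutes S"
    unfolding \<iota> using assms by (intro permutes_compose permutes_swap_id)
  moreover have "\<iota> (\<iota> z) = z" for z
    using inv kx \<kappa>ne by (simp add: ap)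
  moreover have "\<iota> z \<noteq> z" if "z \<in> S" for z
  proof (cases "z = x \<or> z = y")
    case False
    then have "\<kappa> z \<noteq> z" using k that by (auto simp: pairing_def)
    then show ?thesis using False by (simp add: ap)
  qed (use assms(3) ap in auto)
  ultimately show "pairing S \<iota> \<and> \<iota> x = y" by (simp add: pairing_def ap)
qed

text \<open>Because \<open>\<iota> (\<tau> x) = x\<close>, the corner \<open>\<tau> x\<close> is
  already a fixed point of the vertex permutation \<open>\<tau> \<circ> \<iota>\<close>. Removing
  the edge therefore changes that permutation only by skipping \<open>x\<close>.\<close>

lemma excise_comp_transpose:
  assumes "two_faces A B \<tau>" "pairing (A \<union> B) \<iota>" "\<iota> x = \<tau> x" "\<tau> x \<noteq> x" "\<tau> (\<tau> x) \<noteq> x"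
  shows "excise x \<tau> \<circ> (transpose x (\<tau> x) \<circ> \<iota>) = skip x (\<tau> \<circ> \<iota>)"
proof
  fix z
  have inj: "inj \<tau>" using assms(1) by (rule two_faces_inj)
  have inv: "\<And>z. \<iota> (\<iota> z) = z" using assms(2) by (auto simp: pairing_def)
  then have inji: "inj \<iota>" by (metis injI)
  have y: "\<iota> (\<tau> x) = x" using inv assms(3) by metis
  have ix: "\<iota> z = x \<longleftrightarrow> z = \<tau> x" "\<iota> z = \<tau> x \<longleftrightarrow> z = x" using inv y assms(3) by metis+
  have inje: "inj (\<tau> \<circ> \<iota>)" using inj inji by (rule inj_compose)
  have "(transpose x (\<tau> x) \<circ> \<iota>) z = (if z = x \<or> z = \<tau> x then z else \<iota> z)"
    using ix by (auto simp: transpose_def)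
  then have "(excise x \<tau> \<circ> (transpose x (\<tau> x) \<circ> \<iota>)) z =
      (if z = x \<or> z = \<tau> x then z else if \<tau> (\<iota> z) = x then \<tau> (\<tau> x) else \<tau> (\<iota> z))"
    using ix excise_apply[OF inj assms(4,5)] by simp
  moreover have "skip x (\<tau> \<circ> \<iota>) z =
      (if z = x then x else if \<tau> (\<iota> z) = x then \<tau> (\<tau> x) else \<tau> (\<iota> z))"
    using skip_apply[OF inje, of x z] assms(3) by simp
  ultimately show "(excise x \<tau> \<circ> (transpose x (\<tau> x) \<circ> \<iota>)) z = skip x (\<tau> \<circ> \<iota>) z"
    using y assms(4) by simp
qed

text \<open>Two corners disappear and exactly one vertex, the fixed point \<open>\<tau> x\<close>;
  skipping \<open>x\<close> does not change the number of orbits. The equivalence serves both for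
  removing edges and for putting them back.\<close>

lemma annular_excise:
  assumes tf: "two_faces A B \<tau>" and x: "x \<in> A \<union> B" "\<tau> x \<noteq> x" "\<tau> (\<tau> x) \<noteq> x"
  shows "annular A B \<tau> \<iota> \<and> \<iota> x = \<tau> x \<longleftrightarrow>
    annular (A - {x, \<tau> x}) (B - {x, \<tau> x}) (excise x \<tau>) (transpose x (\<tau> x) \<circ> \<iota>)"
proof -
  let ?S = "A \<union> B" and ?y = "\<tau> x"
  let ?\<iota> = "transpose x ?y \<circ> \<iota>" and ?\<tau> = "excise x \<tau>"
  have y: "?y \<in> ?S" using x(1) two_faces_in[OF tf] by auto
  have S: "(A - {x, ?y}) \<union> (B - {x, ?y}) = ?S - {x, ?y}" by auto
  note ps = pairing_skip[OF y x(1) x(2)[symmetric], of \<iota>]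
  have fin: "finite ?S" using two_faces_finite[OF tf] by simp
  have "(\<exists>z\<in>A. \<iota> z \<in> B) \<longleftrightarrow> (\<exists>z\<in>A - {x, ?y}. ?\<iota> z \<in> B - {x, ?y})"
    and "2 * card (orbit (\<tau> \<circ> \<iota>) ` ?S) = card ?S \<longleftrightarrow>
      2 * card (orbit (?\<tau> \<circ> ?\<iota>) ` (?S - {x, ?y})) = card (?S - {x, ?y})"
    if p: "pairing ?S \<iota>" and xy: "\<iota> x = ?y"
  proof -
    have inv: "\<And>z. \<iota> (\<iota> z) = z" using p by (auto simp: pairing_def)
    have yx: "\<iota> ?y = x" using inv xy by metis
    have ix: "\<iota> z = x \<longleftrightarrow> z = ?y" "\<iota> z = ?y \<longleftrightarrow> z = x" for z using inv yx xy by metis+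
    have ap: "?\<iota> z = (if z = x \<or> z = ?y then z else \<iota> z)" for z
      using ix[of z] by (auto simp: transpose_def)
    \<comment> \<open>The removed arc has both ends in one face, so the edges shared by the two
      faces stay the same.\<close>
    have "x \<in> A \<longleftrightarrow> ?y \<in> A" "x \<in> B \<longleftrightarrow> ?y \<in> B" "A \<inter> B = {}"
      using two_faces_in[OF tf] tf by (auto simp: two_faces_def)
    then have "z \<in> A \<and> \<iota> z \<in> B \<longleftrightarrow> z \<in> A - {x, ?y} \<and> ?\<iota> z \<in> B - {x, ?y}" for z
      using ap[of z] ix[of z] yx xy by auto
    then show "(\<exists>z\<in>A. \<iota> z \<in> B) \<longleftrightarrow> (\<exists>z\<in>A - {x, ?y}. ?\<iota> z \<in> B - {x, ?y})"
      by blast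
    have perm: "\<tau> \<circ> \<iota> permutes ?S"
      using p tf by (auto simp: pairing_def two_faces_def intro: permutes_compose)
    have fy: "(\<tau> \<circ> \<iota>) ?y = ?y" and fx: "(\<tau> \<circ> \<iota>) x \<noteq> x" using yx xy x by auto
    have perm': "skip x (\<tau> \<circ> \<iota>) permutes (?S - {x})" using perm x by (intro skip_permutes)
    have "card (orbit (\<tau> \<circ> \<iota>) ` ?S) = card (orbit (skip x (\<tau> \<circ> \<iota>)) ` (?S - {x}))"
      by (rule card_orbits_skip[OF perm fin x(1) fx, symmetric])
    also have "\<dots> = Suc (card (orbit (skip x (\<tau> \<circ> \<iota>)) ` (?S - {x} - {?y})))"
    proof (rule card_orbits_remove_fixpoint[OF perm'])
      show "skip x (\<tau> \<circ> \<iota>) ?y = ?y"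
        using skip_apply[OF permutes_inj[OF perm], of x ?y] fy x by simp
    qed (use fin y x in auto)
    also have "?S - {x} - {?y} = ?S - {x, ?y}" by auto
    finally have "card (orbit (\<tau> \<circ> \<iota>) ` ?S) = Suc (card (orbit (?\<tau> \<circ> ?\<iota>) ` (?S - {x, ?y})))"
      unfolding excise_comp_transpose[OF tf p xy x(2,3)] .
    moreover have "card ?S = card (?S - {x, ?y}) + 2"
    proof -
      have "card (?S - {x, ?y}) = card ?S - card {x, ?y}"
        using x y by (intro card_Diff_subset) auto
      moreover have "card {x, ?y} \<le> card ?S" using fin x y by (intro card_mono) auto
      ultimately show ?thesis using x(2) by auto
    qed
    ultimately show "2 * card (orbit (\<tau> \<circ> \<iota>) ` ?S) = card ?S \<longleftrightarrow>
      2 * card (orbit (?\<tau> \<circ> ?\<iota>) ` (?S - {x, ?y})) = card (?S - {x, ?y})" by simp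
  qed
  then show ?thesis unfolding annular_def S using ps by metis
qed

section \<open>Removal of all glued neighbours\<close>

text \<open>
  In \<open>openers A B \<tau> \<iota> S\<close>, the set \<open>S\<close> consists of the corners at which an arc of \<open>\<iota>\<close> within one
  face opens, when this face is read in the direction of \<open>\<tau>\<close> and each such arc is read so that it
  does not enclose the edges shared by both faces.
\<close>
inductive openers :: "'a set \<Rightarrow> 'a set \<Rightarrow> ('a \<Rightarrow> 'a) \<Rightarrow> ('a \<Rightarrow> 'a) \<Rightarrow> 'a set \<Rightarrow> bool" where
  base: "two_faces A B \<tau> \<Longrightarrow> annular A B \<tau> \<iota> \<Longrightarrow> \<forall>x\<in>A \<union> B. \<iota> x \<noteq> \<tau> x \<Longrightarrow> openers A B \<tau> \<iota> {}"
| step: "two_faces A B \<tau> \<Longrightarrow> annular A B \<tau> \<iota> \<Longrightarrow> x \<in> A \<union> B \<Longrightarrow> \<iota> x = \<tau> x \<Longrightarrow>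
    openers (A - {x, \<tau> x}) (B - {x, \<tau> x}) (excise x \<tau>) (transpose x (\<tau> x) \<circ> \<iota>) S \<Longrightarrow>
    openers A B \<tau> \<iota> (insert x S)"

lemma openers_imp:
  assumes "openers A B \<tau> \<iota> S"
  shows "two_faces A B \<tau>" "annular A B \<tau> \<iota>"
  using assms by (auto elim: openers.cases)

lemma openers_subset: "openers A B \<tau> \<iota> S \<Longrightarrow> S \<subseteq> A \<union> B"
  by (induction rule: openers.induct) auto

lemma card_excised_less:
  assumes "two_faces A B \<tau>" "x \<in> A \<union> B"
  shows "card ((A - {x, y}) \<union> (B - {x, y})) < card (A \<union> B)"
  using assms two_faces_finite[OF assms(1)] by (intro psubset_card_mono) auto

lemma annular_excise_adjacent:
  assumes "two_faces A B \<tau>" "annular A B \<tau> \<iota>" "x \<in> A \<union> B" "\<iota> x = \<tau> x"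
  shows "two_faces (A - {x, \<tau> x}) (B - {x, \<tau> x}) (excise x \<tau>)"
    and "annular (A - {x, \<tau> x}) (B - {x, \<tau> x}) (excise x \<tau>) (transpose x (\<tau> x) \<circ> \<iota>)"
  using two_faces_excise[OF assms(1,3)] annular_excise[OF assms(1,3)]
    annular_adjacent_pair[OF assms] assms by auto

lemma openers_exists:
  assumes "two_faces A B \<tau>" "annular A B \<tau> \<iota>"
  shows "\<exists>S. openers A B \<tau> \<iota> S"
  using assms
proof (induction "card (A \<union> B)" arbitrary: A B \<tau> \<iota> rule: less_induct)
  case less
  show ?case
  proof (cases "\<forall>x\<in>A \<union> B. \<iota> x \<noteq> \<tau> x")
    case True
    then show ?thesis using less.prems openers.base by blast
  next
    case False
    then obtain x where x: "x \<in> A \<union> B" "\<iota> x = \<tau> x" by blast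
    obtain S where
      "openers (A - {x, \<tau> x}) (B - {x, \<tau> x}) (excise x \<tau>) (transpose x (\<tau> x) \<circ> \<iota>) S"
      using less.hyps[OF card_excised_less[OF less.prems(1) x(1)]]
        annular_excise_adjacent[OF less.prems x] by blast
    then show ?thesis using openers.step[OF less.prems x] by blast
  qed
qed

text \<open>Different removable pairs are disjoint and do not disturb each other:
  \<open>y = \<tau> x\<close>, for instance, would give
  \<open>\<tau> (\<tau> x) = \<iota> y = x\<close>, the excluded bigon.\<close>

lemma excise_other_pair:
  assumes tf: "two_faces A B \<tau>" and an: "annular A B \<tau> \<iota>"
    and x: "x \<in> A \<union> B" "\<iota> x = \<tau> x" and y: "y \<in> A \<union> B" "\<iota> y = \<tau> y" and "x \<noteq> y"
  shows "y \<noteq> \<tau> x" "\<tau> y \<noteq> x" "\<tau> y \<noteq> \<tau> x" "excise x \<tau> y = \<tau> y" "(transpose x (\<tau> x) \<circ> \<iota>) y = \<tau> y"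
proof -
  have inj: "inj \<tau>" using tf by (rule two_faces_inj)
  have inv: "\<And>z. \<iota> (\<iota> z) = z" using an by (simp add: annular_def pairing_def)
  note X = annular_adjacent_pair[OF tf an x] and Y = annular_adjacent_pair[OF tf an y]
  have iy: "\<iota> (\<tau> x) = x" "\<iota> (\<tau> y) = y" using inv x y by metis+
  show ne1: "y \<noteq> \<tau> x" using iy X y by metis
  show ne2: "\<tau> y \<noteq> x" using iy Y x by metis
  show ne3: "\<tau> y \<noteq> \<tau> x" using injD[OF inj] assms(7) by metis
  note ne = ne1 ne2 ne3
  show "excise x \<tau> y = \<tau> y"
    using excise_apply[OF inj X, of y] ne assms(7) by simp
  show "(transpose x (\<tau> x) \<circ> \<iota>) y = \<tau> y" using ne y by simp
qed

text \<open>In either order the four removed corners become fixed, and every other corner jumps over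
  the one or two pairs directly ahead of it.\<close>

lemma excise_commute:
  assumes tf: "two_faces A B \<tau>" and an: "annular A B \<tau> \<iota>"
    and x: "x \<in> A \<union> B" "\<iota> x = \<tau> x" and y: "y \<in> A \<union> B" "\<iota> y = \<tau> y" and "x \<noteq> y"
  shows "excise x (excise y \<tau>) = excise y (excise x \<tau>)"
proof
  fix z
  have inj: "inj \<tau>" using tf by (rule two_faces_inj)
  \<comment> \<open>The inner conditionals treat the case that one pair directly follows the other,
    so that the jump has to pass both.\<close>
  have ap: "excise y (excise x \<tau>) z = (if z = x \<or> z = \<tau> x \<or> z = y \<or> z = \<tau> y then z
      else if \<tau> z = x then (if \<tau> (\<tau> x) = y then \<tau> (\<tau> y) else \<tau> (\<tau> x))
      else if \<tau> z = y then (if \<tau> (\<tau> y) = x then \<tau> (\<tau> x) else \<tau> (\<tau> y)) else \<tau> z)"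
    if x: "x \<in> A \<union> B" "\<iota> x = \<tau> x" and y: "y \<in> A \<union> B" "\<iota> y = \<tau> y" and "x \<noteq> y" for x y
  proof -
    note X = annular_adjacent_pair[OF tf an x] and Y = annular_adjacent_pair[OF tf an y]
    note o = excise_other_pair[OF tf an x y that(5)]
    note E = annular_excise_adjacent[OF tf an x]
    have "y \<in> (A - {x, \<tau> x}) \<union> (B - {x, \<tau> x})" using y o that(5) by auto
    from annular_adjacent_pair[OF E this]
    have "excise x \<tau> y \<noteq> y" "excise x \<tau> (excise x \<tau> y) \<noteq> y" using o by auto
    then have "excise y (excise x \<tau>) z = (if z = y \<or> z = \<tau> y then z
        else if excise x \<tau> z = y then excise x \<tau> (\<tau> y) else excise x \<tau> z)"
      using excise_apply[OF two_faces_inj[OF E(1)], of y z] o by simp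
    then show ?thesis
      using o that(5) X Y
      unfolding excise_apply[OF inj X] by (auto simp: inj_eq[OF inj])
  qed
  show "excise x (excise y \<tau>) z = excise y (excise x \<tau>) z"
    unfolding ap[OF x y assms(7)] ap[OF y x assms(7)[symmetric]]
    using assms(7) by (cases "\<tau> z = x"; cases "\<tau> z = y") simp_all
qed

text \<open>This is confluence by well-founded induction on the number of corners: two different
  first removals \<open>x\<close> and \<open>y\<close> are completed to the same gluing, and the
  induction hypothesis applies to each of the two reducts.\<close>

lemma openers_unique:
  assumes "openers A B \<tau> \<iota> S" "openers A B \<tau> \<iota> T"
  shows "S = T"
  using assms
proof (induction "card (A \<union> B)" arbitrary: A B \<tau> \<iota> S T rule: less_induct)
  case less
  note tf = openers_imp(1)[OF less.prems(1)] and an = openers_imp(2)[OF less.prems(1)]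
  let ?red = "\<lambda>A B \<tau> \<iota> x. openers (A - {x, \<tau> x}) (B - {x, \<tau> x}) (excise x \<tau>) (transpose x (\<tau> x) \<circ> \<iota>)"
  show ?case
  proof (cases "\<forall>x\<in>A \<union> B. \<iota> x \<noteq> \<tau> x")
    case True
    have "S = {}" if "openers A B \<tau> \<iota> S" for S
      using that
    proof cases
      case (step x S')
      then show ?thesis using True by blast
    qed simp
    then show ?thesis using less.prems by blast
  next
    case False
    have ex: "\<exists>x S'. x \<in> A \<union> B \<and> \<iota> x = \<tau> x \<and> S = insert x S' \<and> ?red A B \<tau> \<iota> x S'"
      if "openers A B \<tau> \<iota> S" for S
      using that
    proof cases
      case base
      then show ?thesis using False by blast
    next
      case (step x S')
      then show ?thesis by blast
    qed
    obtain x S' where x: "x \<in> A \<union> B" "\<iota> x = \<tau> x" and S: "S = insert x S'" "?red A B \<tau> \<iota> x S'"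
      using ex[OF less.prems(1)] by blast
    obtain y T' where y: "y \<in> A \<union> B" "\<iota> y = \<tau> y" and T: "T = insert y T'" "?red A B \<tau> \<iota> y T'"
      using ex[OF less.prems(2)] by blast
    show ?thesis
    proof (cases "x = y")
      case True
      then show ?thesis using less.hyps[OF card_excised_less[OF tf x(1)]] S T by blast
    next
      case False
      \<comment> \<open>The second removal is expressed through the original \<open>\<tau>\<close>
        and \<open>\<iota>\<close>, which makes the two orders comparable.\<close>
      have sub: "?red (A - {x, \<tau> x}) (B - {x, \<tau> x}) (excise x \<tau>) (transpose x (\<tau> x) \<circ> \<iota>) y R
          \<longleftrightarrow> openers (A - {x, \<tau> x, y, \<tau> y}) (B - {x, \<tau> x, y, \<tau> y}) (excise y (excise x \<tau>))
            (transpose y (\<tau> y) \<circ> (transpose x (\<tau> x) \<circ> \<iota>)) R"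
        and adj: "y \<in> (A - {x, \<tau> x}) \<union> (B - {x, \<tau> x})"
          "(transpose x (\<tau> x) \<circ> \<iota>) y = excise x \<tau> y"
        if x: "x \<in> A \<union> B" "\<iota> x = \<tau> x" and y: "y \<in> A \<union> B" "\<iota> y = \<tau> y" and "x \<noteq> y" for x y R
      proof -
        note o = excise_other_pair[OF tf an x y that(5)]
        have "C - {x, \<tau> x} - {y, \<tau> y} = C - {x, \<tau> x, y, \<tau> y}" for C by auto
        then show "?red (A - {x, \<tau> x}) (B - {x, \<tau> x}) (excise x \<tau>) (transpose x (\<tau> x) \<circ> \<iota>) y R
          \<longleftrightarrow> openers (A - {x, \<tau> x, y, \<tau> y}) (B - {x, \<tau> x, y, \<tau> y}) (excise y (excise x \<tau>))
            (transpose y (\<tau> y) \<circ> (transpose x (\<tau> x) \<circ> \<iota>)) R"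
          using o by simp
        show "y \<in> (A - {x, \<tau> x}) \<union> (B - {x, \<tau> x})" using y o that(5) by auto
        show "(transpose x (\<tau> x) \<circ> \<iota>) y = excise x \<tau> y" using o by simp
      qed
      note E = annular_excise_adjacent[OF tf an x] and F = annular_excise_adjacent[OF tf an y]
      note xy = x y False and yx = y x False[symmetric]
      \<comment> \<open>\<open>R\<close> records the openers left after both removals. It serves
        either order, so \<open>S\<close> and \<open>T\<close> both turn out to be \<open>R\<close>
        together with \<open>x\<close> and \<open>y\<close>.\<close>
      obtain R where R:
        "?red (A - {x, \<tau> x}) (B - {x, \<tau> x}) (excise x \<tau>) (transpose x (\<tau> x) \<circ> \<iota>) y R"
        using openers_exists annular_excise_adjacent[OF E adj[OF xy]] by blast
      have "openers (A - {x, \<tau> x}) (B - {x, \<tau> x}) (excise x \<tau>) (transpose x (\<tau> x) \<circ> \<iota>) (insert y R)"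
        using openers.step[OF E adj[OF xy] R] .
      then have "S' = insert y R"
        using less.hyps[OF card_excised_less[OF tf x(1)]] S by blast
      have ne: "y \<noteq> \<tau> x" "\<tau> y \<noteq> x" "\<tau> y \<noteq> \<tau> x" using excise_other_pair[OF tf an xy] by auto
      have tt: "transpose x (\<tau> x) \<circ> (transpose y (\<tau> y) \<circ> \<iota>) = transpose y (\<tau> y) \<circ> (transpose x (\<tau> x) \<circ> \<iota>)"
        using ne False by (intro ext) (simp add: transpose_def)
      have ss: "{y, \<tau> y, x, \<tau> x} = {x, \<tau> x, y, \<tau> y}" by auto
      have "?red (A - {y, \<tau> y}) (B - {y, \<tau> y}) (excise y \<tau>) (transpose y (\<tau> y) \<circ> \<iota>) x R"
        using R unfolding sub[OF yx] sub[OF xy] by (simp only: tt ss excise_commute[OF tf an xy])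
      then have "openers (A - {y, \<tau> y}) (B - {y, \<tau> y}) (excise y \<tau>) (transpose y (\<tau> y) \<circ> \<iota>) (insert x R)"
        using openers.step[OF F adj[OF yx]] by blast
      then have "T' = insert x R"
        using less.hyps[OF card_excised_less[OF tf y(1)]] T by blast
      then show ?thesis using S T \<open>S' = insert y R\<close> by auto
    qed
  qed
qed

text \<open>An opening bracket directly followed by a closing one is matched with it. Removing
  another pair at \<open>y\<close> keeps \<open>x\<close> and \<open>\<tau> x\<close> neighbours,
  since \<open>\<tau> x \<noteq> y\<close> as \<open>y\<close> is an opener and
  \<open>\<tau> x \<noteq> \<tau> y\<close> by injectivity.\<close>

lemma openers_adjacent:
  assumes "openers A B \<tau> \<iota> S" "x \<in> S" "\<tau> x \<notin> S"
  shows "\<iota> x = \<tau> x"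
  using assms
proof (induction arbitrary: x rule: openers.induct)
  case (step A B \<tau> \<iota> y S)
  show ?case
  proof (cases "x = y")
    case False
    then have "x \<in> S" using step.prems by simp
    then have x: "x \<noteq> y" "x \<noteq> \<tau> y" using openers_subset[OF step.hyps(5)] by auto
    have "\<tau> x \<noteq> y" using step.prems by auto
    note adj = annular_adjacent_pair[OF step.hyps(1-4)]
    have inj: "inj \<tau>" using step.hyps(1) by (rule two_faces_inj)
    have "\<tau> x \<noteq> \<tau> y" using x injD[OF inj] by metis
    have ex: "excise y \<tau> x = \<tau> x" using excise_apply[OF inj adj] x \<open>\<tau> x \<noteq> y\<close> by simp
    then have "(transpose y (\<tau> y) \<circ> \<iota>) x = \<tau> x"
      using step.IH[OF \<open>x \<in> S\<close>] step.prems by simp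
    then show ?thesis using \<open>\<tau> x \<noteq> y\<close> \<open>\<tau> x \<noteq> \<tau> y\<close>
      by (metis comp_apply transpose_apply_other transpose_involutory)
  qed (use step in simp)
qed simp

text \<open>The corner to remove can thus be chosen from \<open>S\<close> and \<open>\<tau>\<close>
  alone, uniformly for all \<open>\<iota>\<close> with opener set \<open>S\<close>. Uniqueness of
  the openers gives the forward direction.\<close>

lemma openers_excise_iff:
  assumes tf: "two_faces A B \<tau>" and x: "x \<in> A \<union> B" "\<tau> x \<noteq> x" "\<tau> (\<tau> x) \<noteq> x"
    and S: "x \<in> S" "\<tau> x \<notin> S"
  shows "openers A B \<tau> \<iota> S \<longleftrightarrow>
    openers (A - {x, \<tau> x}) (B - {x, \<tau> x}) (excise x \<tau>) (transpose x (\<tau> x) \<circ> \<iota>) (S - {x})"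
    (is "_ \<longleftrightarrow> ?R (S - {x})")
proof
  assume L: "openers A B \<tau> \<iota> S"
  note an = openers_imp(2)[OF L] and adj = openers_adjacent[OF L S]
  obtain T where T: "?R T"
    using openers_exists annular_excise_adjacent[OF tf an x(1) adj] by blast
  then have "insert x T = S" using openers.step[OF tf an x(1) adj] openers_unique L by blast
  moreover have "x \<notin> T" using openers_subset[OF T] by auto
  ultimately show "?R (S - {x})" using T by auto
next
  assume R: "?R (S - {x})"
  then have "annular A B \<tau> \<iota> \<and> \<iota> x = \<tau> x"
    using openers_imp(2)[OF R] annular_excise[OF tf x, of \<iota>] by blast
  then have "openers A B \<tau> \<iota> (insert x (S - {x}))" using openers.step[OF tf _ x(1) _ R] by blast
  then show "openers A B \<tau> \<iota> S" using S(1) by (simp add: insert_absorb)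
qed

text \<open>A face contains both corners of the pair or neither; in the first case it loses two
  corners and one opener.\<close>

lemma card_opener_balance:
  assumes "finite C" "x \<in> C \<longleftrightarrow> y \<in> C" "x \<noteq> y" "x \<in> S" "y \<notin> S"
  shows "card C = 2 * card (S \<inter> C) + k \<longleftrightarrow>
    card (C - {x, y}) = 2 * card ((S - {x}) \<inter> (C - {x, y})) + k"
proof (cases "x \<in> C")
  case True
  have "(S - {x}) \<inter> (C - {x, y}) = S \<inter> C - {x}" using assms by auto
  moreover have "card (S \<inter> C) = Suc (card (S \<inter> C - {x}))"
    using assms True by (intro card_Suc_Diff1[symmetric]) auto
  moreover have "card C = card (C - {x, y}) + 2"
  proof -
    have "card C = Suc (card (C - {x}))" using assms True by (intro card_Suc_Diff1[symmetric]) auto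
    also have "card (C - {x}) = Suc (card (C - {x} - {y}))"
      using assms True by (intro card_Suc_Diff1[symmetric]) auto
    also have "C - {x} - {y} = C - {x, y}" by auto
    finally show ?thesis by simp
  qed
  ultimately show ?thesis by simp
next
  case False
  then have "C - {x, y} = C" "(S - {x}) \<inter> C = S \<inter> C" using assms by auto
  then show ?thesis by simp
qed

section \<open>Counting the data with given openers\<close>

lemma card_eq_sum_orbits:
  assumes "f permutes S" "finite S"
  shows "card S = (\<Sum>X\<in>orbit f ` S. card X)"
proof -
  have perm: "permutation f" using assms permutation_permutes by blast
  have "\<Union> (orbit f ` S) = S"
    using permutation_self_in_orbit[OF perm] permutes_orbit_subset[OF assms(1)] by blast
  moreover have "card (\<Union> (orbit f ` S)) = sum card (orbit f ` S)"
  proof (rule card_Union_disjoint)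
    show "pairwise disjnt (orbit f ` S)"
      using orbit_eq_if_common[OF perm] unfolding pairwise_def disjnt_def by blast
    show "finite X" if "X \<in> orbit f ` S" for X
      using that finite_orbit permutation_self_in_orbit[OF perm] by fastforce
  qed
  ultimately show ?thesis by simp
qed

text \<open>Without fixed points every orbit has at least two elements, so there are half as many
  orbits as elements exactly when every orbit has size 2.\<close>

lemma fpf_involution_iff_card_orbits:
  assumes f: "f permutes S" "finite S" and fpf: "\<And>z. z \<in> S \<Longrightarrow> f z \<noteq> z"
  shows "2 * card (orbit f ` S) = card S \<longleftrightarrow> (\<forall>z\<in>S. f (f z) = z)"
proof
  have perm: "permutation f" using f permutation_permutes by blast
  have sub: "{z, f z} \<subseteq> orbit f z" for z
    using permutation_self_in_orbit[OF perm] orbit.base by fast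
  have fin: "finite (orbit f z)" for z
    using finite_orbit permutation_self_in_orbit[OF perm] by fastforce
  have two: "card {z, f z} = 2" if "z \<in> S" for z using fpf[OF that] by simp
  have ge: "2 \<le> card X" if "X \<in> orbit f ` S" for X
    using that two sub card_mono[OF fin] by (metis imageE)
  assume *: "2 * card (orbit f ` S) = card S"
  have eq: "(\<Sum>X\<in>orbit f ` S. 2) = (\<Sum>X\<in>orbit f ` S. card X)"
    using card_eq_sum_orbits[OF f] * by simp
  show "\<forall>z\<in>S. f (f z) = z"
  proof
    fix z assume z: "z \<in> S"
    \<comment> \<open>A single larger orbit would make the sum of the orbit sizes strictly larger
      than twice their number.\<close>
    have "\<not> 2 < card (orbit f z)"
      using sum_strict_mono_ex1[of "orbit f ` S" "\<lambda>_. 2" card] ge z f eq by fastforce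
    then have "card (orbit f z) = card {z, f z}" using ge two[OF z] z by force
    then have "orbit f z = {z, f z}" using sub card_subset_eq[OF fin] by metis
    then have "f (f z) \<in> {z, f z}" using orbit.step[OF orbit.base, of f z] by simp
    then show "f (f z) = z"
      using fpf[OF z] injD[OF permutes_inj[OF f(1)]] by blast
  qed
next
  assume *: "\<forall>z\<in>S. f (f z) = z"
  have "card X = 2" if X: "X \<in> orbit f ` S" for X
  proof -
    obtain z where z: "z \<in> S" "X = orbit f z" using X by blast
    then have "X = {z, f z}" using * orbit_two by metis
    then show ?thesis using fpf[OF z(1)] by simp
  qed
  then show "2 * card (orbit f ` S) = card S"
    using card_eq_sum_orbits[OF f] by simp
qed

lemma pairing_comp_permutes:
  assumes "two_faces A B \<tau>" "pairing (A \<union> B) \<iota>"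
  shows "\<tau> \<circ> \<iota> permutes (A \<union> B)"
  using assms by (auto simp: pairing_def two_faces_def intro: permutes_compose)

text \<open>A fixed point of \<open>\<tau> \<circ> \<iota>\<close> is the same as a pair of glued
  neighbours. In their absence the vertex count makes \<open>\<tau> \<circ> \<iota>\<close> an
  involution, that is, \<open>\<iota>\<close> conjugates \<open>\<tau>\<close> to its
  inverse.\<close>

lemma openers_empty_iff:
  assumes tf: "two_faces A B \<tau>"
  shows "openers A B \<tau> \<iota> {} \<longleftrightarrow>
    pairing (A \<union> B) \<iota> \<and> (\<exists>x\<in>A. \<iota> x \<in> B) \<and> (\<forall>x\<in>A \<union> B. \<iota> x \<noteq> \<tau> x) \<and>
    (\<forall>x\<in>A \<union> B. \<tau> (\<iota> (\<tau> x)) = \<iota> x)" (is "_ \<longleftrightarrow> ?R")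
proof -
  let ?S = "A \<union> B"
  have "openers A B \<tau> \<iota> {} \<longleftrightarrow> annular A B \<tau> \<iota> \<and> (\<forall>x\<in>?S. \<iota> x \<noteq> \<tau> x)"
    using openers.base[OF tf] openers.cases[of A B \<tau> \<iota> "{}"] by blast
  moreover have "2 * card (orbit (\<tau> \<circ> \<iota>) ` ?S) = card ?S \<longleftrightarrow> (\<forall>x\<in>?S. \<tau> (\<iota> (\<tau> x)) = \<iota> x)"
    if p: "pairing ?S \<iota>" and "\<forall>x\<in>?S. \<iota> x \<noteq> \<tau> x"
  proof -
    have inv: "\<And>z. \<iota> (\<iota> z) = z" using p by (auto simp: pairing_def)
    have "2 * card (orbit (\<tau> \<circ> \<iota>) ` ?S) = card ?S \<longleftrightarrow> (\<forall>z\<in>?S. (\<tau> \<circ> \<iota>) ((\<tau> \<circ> \<iota>) z) = z)"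
    proof (rule fpf_involution_iff_card_orbits[OF pairing_comp_permutes[OF tf p]])
      show "finite ?S" using two_faces_finite[OF tf] by simp
      show "(\<tau> \<circ> \<iota>) z \<noteq> z" if "z \<in> ?S" for z
        using that \<open>\<forall>x\<in>?S. \<iota> x \<noteq> \<tau> x\<close> inv pairing_in[OF p] by (metis comp_apply)
    qed
    also have "\<dots> \<longleftrightarrow> (\<forall>x\<in>?S. \<tau> (\<iota> (\<tau> x)) = \<iota> x)"
      using inv pairing_in[OF p] by (metis comp_apply)
    finally show ?thesis .
  qed
  ultimately show ?thesis unfolding annular_def by metis
qed

text \<open>A step of \<open>\<tau>\<close> in one face becomes a backward step at the other end of
  the edge. One shared edge therefore forces every edge of the face to be shared.\<close>

lemma openers_empty_swaps:
  assumes tf: "two_faces A B \<tau>" and op: "openers A B \<tau> \<iota> {}"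
  shows "\<iota> ` A = B" "card A = card B"
proof -
  note R = op[unfolded openers_empty_iff[OF tf]]
  have inv: "\<And>z. \<iota> (\<iota> z) = z" using R by (auto simp: pairing_def)
  have swap: "\<iota> ` A \<subseteq> B" if tf: "two_faces A B \<tau>" and a: "a \<in> A" "\<iota> a \<in> B"
    and anti: "\<forall>x\<in>A. \<tau> (\<iota> (\<tau> x)) = \<iota> x" for A B a
  proof -
    have "\<iota> z \<in> B \<and> z \<in> A" if "z \<in> orbit \<tau> a" for z
      using that
    proof induction
      case base
      show ?case using anti a two_faces_in[OF tf] by metis
    next
      case (step z)
      then show ?case using anti two_faces_in[OF tf] by metis
    qed
    moreover have "A = orbit \<tau> a"
      using tf a orbit_cyclic_eq3 unfolding two_faces_def by metis
    ultimately show ?thesis by blast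
  qed
  obtain a where a: "a \<in> A" "\<iota> a \<in> B" using R by blast
  have 1: "\<iota> ` A \<subseteq> B" using swap[OF tf a] R by blast
  have 2: "\<iota> ` B \<subseteq> A" using swap[of B A "\<iota> a"] tf a inv R two_faces_commute by (metis UnI2)
  show "\<iota> ` A = B" using 1 2 inv by (metis image_subset_iff subsetI subset_antisym image_eqI)
  moreover have "inj_on \<iota> A" using inv by (metis inj_onI)
  ultimately show "card A = card B" using card_image by metis
qed

lemma funpow_cyclic_on_eq_iff:
  assumes c: "cyclic_on f A" and a: "a \<in> A"
  shows "(f ^^ m) a = (f ^^ n) a \<longleftrightarrow> m mod card A = n mod card A"
proof -
  have A: "A = orbit f a" and self: "a \<in> orbit f a" using c a by (auto simp: cyclic_on_alldef)
  define k where "k = funpow_dist1 f a a"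
  have fix_k: "(f ^^ k) a = a" unfolding k_def using self by (rule funpow_dist1_prop)
  have inj: "inj_on (\<lambda>n. (f ^^ n) a) {0..<k}" unfolding k_def using self by (rule inj_on_funpow_dist1)
  have "A = (\<lambda>n. (f ^^ n) a) ` {0..<k}" unfolding A k_def using self by (rule orbit_conv_funpow_dist1)
  then have k: "card A = k" using card_image[OF inj] by simp
  have "(f ^^ m) a = (f ^^ (m mod k)) a" for m using fix_k by (simp add: funpow_mod_eq)
  moreover have "0 < k" by (simp add: k_def)
  ultimately show ?thesis unfolding k using inj_onD[OF inj, of "m mod k" "n mod k"] by (metis atLeastLessThan_iff mod_less_divisor zero_le)
qed

lemma cyclic_on_surj_funpow:
  assumes c: "cyclic_on f A" and a: "a \<in> A" and z: "z \<in> A"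
  obtains n where "z = (f ^^ Suc n) a"
proof -
  have "z \<in> orbit f a" using c a z by (auto simp: cyclic_on_alldef)
  then obtain n where n: "0 < n" "z = (f ^^ n) a" unfolding orbit_altdef by blast
  then obtain m where "n = Suc m" using gr0_implies_Suc by blast
  then show thesis using that[of m] n by blast
qed

lemma permutes_involutionI:
  assumes "\<And>z. f (f z) = z" "\<And>z. z \<notin> S \<Longrightarrow> f z = z"
  shows "f permutes S"
  using assms unfolding permutes_def by metis

text \<open>As \<open>\<iota>\<close> reverses \<open>\<tau>\<close>, it is determined by the image
  of one corner \<open>a\<close> of \<open>A\<close>, and every corner \<open>b\<close> of
  \<open>B\<close> can be that image.\<close>

lemma count_openers_empty:
  assumes tf: "two_faces A B \<tau>" and card: "card A = card B"
  shows "card {\<iota>. openers A B \<tau> \<iota> {}} = card A"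
proof -
  note iff = openers_empty_iff[OF tf]
  have dis: "A \<inter> B = {}" and perm: "\<tau> permutes (A \<union> B)" and cA: "cyclic_on \<tau> A" and cB: "cyclic_on \<tau> B"
    using tf by (auto simp: two_faces_def)
  have inj: "inj \<tau>" using tf by (rule two_faces_inj)
  obtain a where a: "a \<in> A" using cA by (auto simp: cyclic_on_def)
  have "bij_betw (\<lambda>\<iota>. \<iota> a) {\<iota>. openers A B \<tau> \<iota> {}} B"
    unfolding bij_betw_def
  proof (intro conjI inj_onI equalityI subsetI)
    fix \<iota> \<kappa> assume "\<iota> \<in> {\<iota>. openers A B \<tau> \<iota> {}}" "\<kappa> \<in> {\<iota>. openers A B \<tau> \<iota> {}}" and eq: "\<iota> a = \<kappa> a"
    then have op: "openers A B \<tau> \<iota> {}" "openers A B \<tau> \<kappa> {}" by auto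
    note R = op[unfolded iff]
    have inv: "\<iota> (\<iota> z) = z" "\<kappa> (\<kappa> z) = z" for z using R by (auto simp: pairing_def)
    have A: "\<iota> z = \<kappa> z" if "z \<in> A" for z
    proof -
      have "z \<in> A \<and> \<iota> z = \<kappa> z" if "z \<in> orbit \<tau> a" for z
        using that
      proof induction
        case base
        have "\<tau> (\<iota> (\<tau> a)) = \<tau> (\<kappa> (\<tau> a))" using R a eq by auto
        then show ?case using injD[OF inj] a two_faces_in[OF tf] by metis
      next
        case (step z)
        then have "\<tau> (\<iota> (\<tau> z)) = \<tau> (\<kappa> (\<tau> z))" using R by auto
        then show ?case using injD[OF inj] step two_faces_in[OF tf] by metis
      qed
      then show ?thesis using that cA a by (metis orbit_cyclic_eq3)
    qed
    have B: "\<iota> z = \<kappa> z" if z: "z \<in> B" for z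
    proof -
      obtain w where "w \<in> A" "z = \<iota> w" using z openers_empty_swaps(1)[OF tf op(1)] by blast
      then show ?thesis using A inv by metis
    qed
    show "\<iota> = \<kappa>"
    proof
      fix z
      show "\<iota> z = \<kappa> z"
      proof (cases "z \<in> A \<union> B")
        case True
        then show ?thesis using A B by blast
      next
        case False
        then show ?thesis using R permutes_not_in unfolding pairing_def by metis
      qed
    qed
  next
    fix b assume "b \<in> (\<lambda>\<iota>. \<iota> a) ` {\<iota>. openers A B \<tau> \<iota> {}}"
    then show "b \<in> B" using openers_empty_swaps(1)[OF tf] a by blast
  next
    fix b assume b: "b \<in> B"
    \<comment> \<open>\<open>\<alpha>\<close> runs forward around \<open>A\<close> from
      \<open>a\<close>, and \<open>\<beta>\<close> backward around \<open>B\<close> from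
      \<open>b\<close>; the required pairing swaps \<open>\<alpha> n\<close> and
      \<open>\<beta> n\<close>.\<close>
    define \<alpha> where "\<alpha> n = (\<tau> ^^ n) a" for n
    define \<beta> where "\<beta> n = (inv' \<tau> ^^ n) b" for n
    have fin: "finite (A \<union> B)" using two_faces_finite[OF tf] by simp
    then have "permutation \<tau>" using perm permutation_permutes by blast
    then have cB': "cyclic_on (inv' \<tau>) B" using cB by (simp add: cyclic_on_alldef orbit_inv_eq)
    have eq: "\<alpha> m = \<alpha> n \<longleftrightarrow> \<beta> m = \<beta> n" for m n
      unfolding \<alpha>_def \<beta>_def funpow_cyclic_on_eq_iff[OF cA a] funpow_cyclic_on_eq_iff[OF cB' b] card ..
    have \<alpha>A: "\<alpha> n \<in> A" and \<beta>B: "\<beta> n \<in> B" for n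
      unfolding \<alpha>_def \<beta>_def using cyclic_on_funpow_in cA a cB' b by metis+
    \<comment> \<open>The choice of index does not matter: as both faces have the same size,
      \<open>eq\<close> says that \<open>\<alpha>\<close> and \<open>\<beta>\<close> identify the
      same indices.\<close>
    define \<iota> where "\<iota> z = (if z \<in> A then \<beta> (SOME n. \<alpha> n = z) else if z \<in> B then \<alpha> (SOME n. \<beta> n = z) else z)" for z
    have \<iota>\<alpha>: "\<iota> (\<alpha> n) = \<beta> n" for n
    proof -
      have "\<alpha> (SOME m. \<alpha> m = \<alpha> n) = \<alpha> n" by (rule someI) (rule refl)
      then show ?thesis using \<alpha>A by (simp add: \<iota>_def eq)
    qed
    have \<iota>\<beta>: "\<iota> (\<beta> n) = \<alpha> n" for n
    proof -
      have "\<beta> (SOME m. \<beta> m = \<beta> n) = \<beta> n" by (rule someI) (rule refl)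
      moreover have "\<beta> n \<notin> A" using \<beta>B dis by blast
      ultimately show ?thesis using \<beta>B by (simp add: \<iota>_def eq)
    qed
    have \<iota>_out: "\<iota> z = z" if "z \<notin> A \<union> B" for z using that by (simp add: \<iota>_def)
    \<comment> \<open>Positive indices are needed because \<open>\<tau>\<close> lowers the index of
      \<open>\<beta>\<close> by one.\<close>
    have repr: "\<exists>n. z = \<alpha> (Suc n) \<or> z = \<beta> (Suc n)" if "z \<in> A \<union> B" for z
      using that cyclic_on_surj_funpow[OF cA a] cyclic_on_surj_funpow[OF cB' b]
      unfolding \<alpha>_def \<beta>_def by (metis Un_iff)
    have inv: "\<iota> (\<iota> z) = z" for z
      using repr[of z] \<iota>\<alpha> \<iota>\<beta> \<iota>_out by (cases "z \<in> A \<union> B") auto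
    have \<tau>\<alpha>: "\<tau> (\<alpha> n) = \<alpha> (Suc n)" and \<tau>\<beta>: "\<tau> (\<beta> (Suc n)) = \<beta> n" for n
      using permutes_inverses[OF perm] by (auto simp: \<alpha>_def \<beta>_def)
    have anti: "\<tau> (\<iota> (\<tau> z)) = \<iota> z" if "z \<in> A \<union> B" for z
      using repr[OF that] by (auto simp: \<tau>\<alpha> \<tau>\<beta> \<iota>\<alpha> \<iota>\<beta>)
    have swap: "z \<in> A \<and> \<iota> z \<in> B \<or> z \<in> B \<and> \<iota> z \<in> A" if "z \<in> A \<union> B" for z
      using repr[OF that] \<alpha>A \<beta>B \<iota>\<alpha> \<iota>\<beta> by metis
    have "\<iota> permutes (A \<union> B)" using inv \<iota>_out by (rule permutes_involutionI)
    moreover have "\<iota> z \<noteq> z" "\<iota> z \<noteq> \<tau> z" if "z \<in> A \<union> B" for z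
      using swap[OF that] two_faces_in[OF tf, of z] dis by auto
    moreover have "\<exists>x\<in>A. \<iota> x \<in> B" using swap[of a] a dis by blast
    ultimately have "openers A B \<tau> \<iota> {}" unfolding iff pairing_def using inv anti by blast
    moreover have "\<iota> a = b" using \<iota>\<alpha>[of 0] by (simp add: \<alpha>_def \<beta>_def)
    ultimately show "b \<in> (\<lambda>\<iota>. \<iota> a) ` {\<iota>. openers A B \<tau> \<iota> {}}" by blast
  qed
  then show ?thesis using bij_betw_same_card card by metis
qed

text \<open>Here \<open>k\<close> is the common size of the two faces once all removals are done;
  every removal preserves \<open>card A - 2 * card (S \<inter> A)\<close> and its analogue for
  \<open>B\<close>.\<close>

lemma openers_balance:
  assumes "openers A B \<tau> \<iota> S"
  shows "\<exists>k>0. card A = 2 * card (S \<inter> A) + k \<and> card B = 2 * card (S \<inter> B) + k"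
  using assms
proof induction
  case (base A B \<tau> \<iota>)
  then have "card A = card B" using openers_empty_swaps(2) openers.base by blast
  moreover have "0 < card A"
    using base two_faces_finite[OF base(1)] by (auto simp: two_faces_def cyclic_on_def card_gt_0_iff)
  ultimately show ?case by simp
next
  case (step A B \<tau> \<iota> x S)
  note in_iff = two_faces_in[OF step.hyps(1), of x, symmetric]
  note fin = two_faces_finite[OF step.hyps(1)]
  have ne: "x \<noteq> \<tau> x" using annular_adjacent_pair(1)[OF step.hyps(1-4)] by simp
  have sub: "x \<notin> S" "\<tau> x \<notin> S" using openers_subset[OF step.hyps(5)] by auto
  then have S: "insert x S - {x} = S" "x \<in> insert x S" "\<tau> x \<notin> insert x S" using ne by auto
  show ?case
    using step.IH card_opener_balance[OF fin(1) in_iff(1) ne S(2,3)]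
      card_opener_balance[OF fin(2) in_iff(2) ne S(2,3)] unfolding S(1) by simp
qed

text \<open>If every opener in \<open>A\<close> were followed by another one, going around the face
  would make all its corners openers, but fewer than half of them are.\<close>

lemma exists_removable_opener:
  assumes tf: "two_faces A B \<tau>" and SA: "S \<inter> A \<noteq> {}"
    and A: "card A = 2 * card (S \<inter> A) + k" "0 < k"
  obtains x where "x \<in> S \<inter> A" "\<tau> x \<notin> S" "\<tau> x \<noteq> x" "\<tau> (\<tau> x) \<noteq> x"
proof -
  have fin: "finite A" using two_faces_finite[OF tf] by simp
  have "\<exists>x\<in>S \<inter> A. \<tau> x \<notin> S"
  proof (rule ccontr)
    assume no: "\<not> ?thesis"
    obtain a where a: "a \<in> S \<inter> A" using SA by blast
    have "z \<in> S \<inter> A" if "z \<in> orbit \<tau> a" for z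
      using that by induction (use no a two_faces_in[OF tf] in blast)+
    moreover have "A = orbit \<tau> a" using tf a orbit_cyclic_eq3 unfolding two_faces_def by (metis IntD2)
    ultimately have "S \<inter> A = A" by blast
    then show False using A by simp
  qed
  then obtain x where x: "x \<in> S \<inter> A" "\<tau> x \<notin> S" by blast
  \<comment> \<open>One opener and \<open>k > 0\<close> give at least three corners, so the face is
    not a bigon.\<close>
  have "1 \<le> card (S \<inter> A)" using x fin by (metis One_nat_def Suc_leI card_gt_0_iff empty_iff finite_Int)
  then have "card A \<ge> 3" using A by simp
  moreover have "card {x, \<tau> x} \<le> 2" by (simp add: card_insert_if)
  ultimately have "\<tau> (\<tau> x) \<noteq> x" using two_faces_bigon[OF tf, of x] x by force
  moreover have "\<tau> x \<noteq> x" using x by auto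
  ultimately show thesis using x by (intro that)
qed

text \<open>Removing an opener followed by a non-opener is a bijection onto the data of a smaller
  case with the same \<open>k\<close>; the induction ends at \<open>S = {}\<close>.\<close>

lemma count_openers:
  assumes "two_faces A B \<tau>" "S \<subseteq> A \<union> B" "0 < k"
    "card A = 2 * card (S \<inter> A) + k" "card B = 2 * card (S \<inter> B) + k"
  shows "card {\<iota>. openers A B \<tau> \<iota> S} = k"
  using assms
proof (induction "card S" arbitrary: A B \<tau> S rule: less_induct)
  case less
  note tf = less.prems(1)
  show ?case
  proof (cases "S = {}")
    case True
    then show ?thesis using count_openers_empty[OF tf] less.prems by simp
  next
    case False
    have finS: "finite S" using less.prems(2) two_faces_finite[OF tf] finite_subset by blast
    obtain x where x: "x \<in> S" "\<tau> x \<notin> S" "\<tau> x \<noteq> x" "\<tau> (\<tau> x) \<noteq> x"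
    proof (cases "S \<inter> A = {}")
      case True
      then have "S \<inter> B \<noteq> {}" using False less.prems(2) by blast
      moreover have "two_faces B A \<tau>" using tf by (simp add: two_faces_commute)
      ultimately obtain x where "x \<in> S \<inter> B" "\<tau> x \<notin> S" "\<tau> x \<noteq> x" "\<tau> (\<tau> x) \<noteq> x"
        using exists_removable_opener less.prems by metis
      then show thesis by (intro that) auto
    next
      case False
      then obtain x where "x \<in> S \<inter> A" "\<tau> x \<notin> S" "\<tau> x \<noteq> x" "\<tau> (\<tau> x) \<noteq> x"
        using exists_removable_opener[OF tf] less.prems by metis
      then show thesis by (intro that) auto
    qed
    let ?A = "A - {x, \<tau> x}" and ?B = "B - {x, \<tau> x}" and ?t = "(\<circ>) (transpose x (\<tau> x))"
    have xAB: "x \<in> A \<union> B" using x less.prems(2) by blast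
    note iff = openers_excise_iff[OF tf xAB x(3,4,1,2)]
    have tt: "?t (?t \<iota>) = \<iota>" for \<iota> :: "'a \<Rightarrow> 'a" by (simp add: fun_eq_iff)
    have "bij_betw ?t {\<iota>. openers A B \<tau> \<iota> S} {\<iota>. openers ?A ?B (excise x \<tau>) \<iota> (S - {x})}"
      by (rule bij_betw_byWitness[where f' = ?t]) (use iff tt in auto)
    then have "card {\<iota>. openers A B \<tau> \<iota> S} = card {\<iota>. openers ?A ?B (excise x \<tau>) \<iota> (S - {x})}"
      by (rule bij_betw_same_card)
    also have "\<dots> = k"
    proof (rule less.hyps)
      show "card (S - {x}) < card S" using finS x by (meson card_Diff1_less)
      show "two_faces ?A ?B (excise x \<tau>)" using two_faces_excise[OF tf xAB x(3,4)] .
      show "S - {x} \<subseteq> ?A \<union> ?B" using less.prems(2) x by auto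
      note fin = two_faces_finite[OF tf] and in_iff = two_faces_in[OF tf, of x, symmetric]
      show "card ?A = 2 * card ((S - {x}) \<inter> ?A) + k"
        using card_opener_balance[OF fin(1) in_iff(1) x(3)[symmetric] x(1,2), of k] less.prems by blast
      show "card ?B = 2 * card ((S - {x}) \<inter> ?B) + k"
        using card_opener_balance[OF fin(2) in_iff(2) x(3)[symmetric] x(1,2), of k] less.prems by blast
    qed (use less.prems in simp)
    finally show ?thesis .
  qed
qed

section \<open>Summation over all sets of openers\<close>

lemma finite_annular:
  assumes "two_faces A B \<tau>" shows "finite {\<iota>. annular A B \<tau> \<iota>}"
  by (rule finite_subset[OF _ finite_permutations[of "A \<union> B"]])
    (use two_faces_finite[OF assms] in \<open>auto simp: annular_def pairing_def\<close>)

text \<open>Existence and uniqueness of openers partition the data by their opener sets. The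
  differences are integers, since truncated subtraction would make unbalanced sets look balanced;
  \<open>nat\<close> discards the values \<open>k \<le> 0\<close>.\<close>

lemma card_annular:
  assumes tf: "two_faces A B \<tau>"
  shows "card {\<iota>. annular A B \<tau> \<iota>} = (\<Sum>S\<in>Pow A. \<Sum>T\<in>Pow B.
    if int (card A) - 2 * int (card S) = int (card B) - 2 * int (card T)
    then nat (int (card A) - 2 * int (card S)) else 0)"
proof -
  have dis: "A \<inter> B = {}" using tf by (simp add: two_faces_def)
  have fin: "finite A" "finite B" using two_faces_finite[OF tf] by auto
  let ?O = "\<lambda>U. {\<iota>. openers A B \<tau> \<iota> U}"
  have "{\<iota>. annular A B \<tau> \<iota>} = (\<Union>(S, T)\<in>Pow A \<times> Pow B. ?O (S \<union> T))"
  proof (intro equalityI subsetI)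
    fix \<iota> assume "\<iota> \<in> {\<iota>. annular A B \<tau> \<iota>}"
    then obtain U where U: "openers A B \<tau> \<iota> U" using openers_exists[OF tf] by blast
    then have "U = (U \<inter> A) \<union> (U \<inter> B)" using openers_subset by blast
    then show "\<iota> \<in> (\<Union>(S, T)\<in>Pow A \<times> Pow B. ?O (S \<union> T))"
      using U by (intro UN_I[where a = "(U \<inter> A, U \<inter> B)"]) auto
  qed (auto dest: openers_imp(2))
  also have "card \<dots> = (\<Sum>(S, T)\<in>Pow A \<times> Pow B. card (?O (S \<union> T)))"
  proof (subst card_UN_disjoint)
    show "\<forall>p\<in>Pow A \<times> Pow B. finite (case p of (S, T) \<Rightarrow> ?O (S \<union> T))"
      using openers_imp(2) by (auto intro!: finite_subset[OF _ finite_annular[OF tf]])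
    show "\<forall>p\<in>Pow A \<times> Pow B. \<forall>q\<in>Pow A \<times> Pow B. p \<noteq> q \<longrightarrow>
      (case p of (S, T) \<Rightarrow> ?O (S \<union> T)) \<inter> (case q of (S, T) \<Rightarrow> ?O (S \<union> T)) = {}"
    proof (clarify, rule ccontr)
      fix S T S' T' assume sub: "S \<subseteq> A" "T \<subseteq> B" "S' \<subseteq> A" "T' \<subseteq> B"
        and ne: "\<not> (S = S' \<and> T = T')" and "?O (S \<union> T) \<inter> ?O (S' \<union> T') \<noteq> {}"
      then have "S \<union> T = S' \<union> T'" using openers_unique by blast
      moreover have "S = (S \<union> T) \<inter> A" "T = (S \<union> T) \<inter> B" "S' = (S' \<union> T') \<inter> A" "T' = (S' \<union> T') \<inter> B"
        using sub dis by auto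
      ultimately show False using ne by metis
    qed
  qed (use fin in \<open>auto intro!: sum.cong\<close>)
  also have "\<dots> = (\<Sum>S\<in>Pow A. \<Sum>T\<in>Pow B. card (?O (S \<union> T)))"
    by (simp add: sum.cartesian_product)
  also have "\<dots> = (\<Sum>S\<in>Pow A. \<Sum>T\<in>Pow B.
    if int (card A) - 2 * int (card S) = int (card B) - 2 * int (card T)
    then nat (int (card A) - 2 * int (card S)) else 0)"
  proof (intro sum.cong refl)
    fix S T assume "S \<in> Pow A" "T \<in> Pow B"
    then have sub: "S \<union> T \<subseteq> A \<union> B" and S: "(S \<union> T) \<inter> A = S" "(S \<union> T) \<inter> B = T" using dis by auto
    let ?k = "int (card A) - 2 * int (card S)"
    show "card (?O (S \<union> T)) = (if ?k = int (card B) - 2 * int (card T) then nat ?k else 0)"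
    proof (cases "?k = int (card B) - 2 * int (card T) \<and> 0 < ?k")
      case True
      then have "0 < nat ?k" "card A = 2 * card ((S \<union> T) \<inter> A) + nat ?k" "card B = 2 * card ((S \<union> T) \<inter> B) + nat ?k"
        unfolding S by linarith+
      then have "card (?O (S \<union> T)) = nat ?k" by (rule count_openers[OF tf sub])
      then show ?thesis using True by simp
    next
      case False
      have "?O (S \<union> T) = {}"
      proof (rule ccontr)
        assume "?O (S \<union> T) \<noteq> {}"
        then obtain \<iota> where "openers A B \<tau> \<iota> (S \<union> T)" by blast
        from openers_balance[OF this] show False using False unfolding S by auto
      qed
      then show ?thesis using False by auto
    qed
  qed
  finally show ?thesis .
qed

section \<open>Summation\<close>

lemma sum_Pow_card:
  fixes f :: "nat \<Rightarrow> nat"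
  assumes "finite A"
  shows "(\<Sum>S\<in>Pow A. f (card S)) = (\<Sum>i\<le>card A. (card A choose i) * f i)"
proof -
  have "(\<Sum>S\<in>Pow A. f (card S)) = (\<Sum>i\<le>card A. \<Sum>S | S \<in> Pow A \<and> card S = i. f (card S))"
    using assms by (intro sum.group[symmetric]) (auto intro: card_mono)
  also have "\<dots> = (\<Sum>i\<le>card A. (card A choose i) * f i)"
  proof (intro sum.cong refl)
    fix i
    have "(\<Sum>S | S \<in> Pow A \<and> card S = i. f (card S)) = (\<Sum>S | S \<subseteq> A \<and> card S = i. f i)"
      by (intro sum.cong) auto
    then show "(\<Sum>S | S \<in> Pow A \<and> card S = i. f (card S)) = (card A choose i) * f i"
      using n_subsets[OF assms, of i] by simp
  qed
  finally show ?thesis .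
qed

definition annular_number :: "nat \<Rightarrow> nat \<Rightarrow> nat" where
  "annular_number N p = (\<Sum>i\<le>p. (p choose i) * ((p - 2 * i) * ((2 * N - p) choose (N - i))))"

lemma card_annular_eq_annular_number:
  assumes tf: "two_faces A B \<tau>" and N: "card A + card B = 2 * N"
  shows "card {\<iota>. annular A B \<tau> \<iota>} = annular_number N (card A)"
proof -
  define p q where "p = card A" and "q = card B"
  have fin: "finite A" "finite B" using two_faces_finite[OF tf] by auto
  let ?f = "\<lambda>i j. if int p - 2 * int i = int q - 2 * int j then nat (int p - 2 * int i) else 0"
  have "card {\<iota>. annular A B \<tau> \<iota>} = (\<Sum>S\<in>Pow A. \<Sum>T\<in>Pow B. ?f (card S) (card T))"
    unfolding p_def q_def by (rule card_annular[OF tf])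
  also have "\<dots> = (\<Sum>S\<in>Pow A. \<Sum>j\<le>q. (q choose j) * ?f (card S) j)"
    unfolding q_def by (intro sum.cong refl sum_Pow_card[OF fin(2)])
  also have "\<dots> = (\<Sum>i\<le>p. (p choose i) * (\<Sum>j\<le>q. (q choose j) * ?f i j))"
    unfolding p_def by (rule sum_Pow_card[OF fin(1)])
  also have "\<dots> = (\<Sum>i\<le>p. (p choose i) * ((p - 2 * i) * (q choose (N - i))))"
  proof (intro sum.cong refl arg_cong2[where f = "(*)"])
    fix i assume "i \<in> {..p}"
    show "(\<Sum>j\<le>q. (q choose j) * ?f i j) = (p - 2 * i) * (q choose (N - i))"
    proof (cases "2 * i < p \<and> N - i \<le> q")
      case True
      \<comment> \<open>Balance and \<open>p + q = 2 * N\<close> leave this single \<open>j\<close>.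
        Symmetry of the binomial coefficient then yields \<open>q choose (N - i)\<close>.\<close>
      define j where "j = q - (N - i)"
      have eq: "int p - 2 * int i = int q - 2 * int j' \<longleftrightarrow> j' = j" for j'
        using True N unfolding j_def p_def q_def by linarith
      have "(\<Sum>j'\<le>q. (q choose j') * ?f i j') = (\<Sum>j'\<in>{j}. (q choose j') * ?f i j')"
        unfolding eq by (rule sum.mono_neutral_right) (auto simp: j_def)
      also have "\<dots> = (q choose j) * (p - 2 * i)"
        using eq[of j] by simp linarith
      also have "q choose j = q choose (N - i)" unfolding j_def using True binomial_symmetric by metis
      finally show ?thesis by (simp only: mult.commute)
    next
      case False
      have "?f i j = 0" if "j \<le> q" for j
        using that False N unfolding p_def q_def by auto
      then show ?thesis using False by (auto simp: binomial_eq_0)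
    qed
  qed
  also have "q = 2 * N - p" using N by (simp add: p_def q_def)
  finally show ?thesis by (simp add: p_def annular_number_def)
qed

section \<open>Closed form of the sum for fixed face sizes\<close>

lemma Suc_times_binomial_Suc: "Suc k * (n choose Suc k) = (n - k) * (n choose k)"
  using binomial_absorption[of k n] binomial_absorb_comp[of n k] by simp

lemma Suc_times_binomial_Suc_int:
  "(int k + 1) * int (n choose Suc k) = (int n - int k) * int (n choose k)"
proof (cases "k \<le> n")
  case True
  then show ?thesis using arg_cong[OF Suc_times_binomial_Suc[of k n], of int]
    by (simp add: of_nat_diff algebra_simps)
qed (simp add: binomial_eq_0)

text \<open>Gosper's algorithm finds this antidifference of \<open>(p - 2 * i) * (p choose i) * (q choose (N - i))\<close>.\<close>
lemma binomial_product_telescope: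
  assumes "p + q = 2 * N" "m \<le> N"
  shows "int N * (\<Sum>i<m. (int p - 2 * int i) * (int (p choose i) * int (q choose (N - i)))) =
    int m * (int q - int N + int m) * (int (p choose m) * int (q choose (N - m)))"
  using assms(2)
proof (induction m)
  case (Suc m)
  define c where "c = N - Suc m"
  have c: "N - m = Suc c" "N - Suc m = c" "int c = int N - int m - 1"
    using Suc.prems by (auto simp: c_def)
  define x y where "x = int (p choose m)" and "y = int (q choose Suc c)"
  have P: "(int m + 1) * int (p choose Suc m) = (int p - int m) * x"
    unfolding x_def by (rule Suc_times_binomial_Suc_int)
  have Q: "(int q - int N + int m + 1) * int (q choose c) = (int N - int m) * y"
    using Suc_times_binomial_Suc_int[of c q] unfolding y_def c(3) by (simp add: algebra_simps)
  have q: "int q = 2 * int N - int p" using assms(1) by linarith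
  have "int N * (\<Sum>i<Suc m. (int p - 2 * int i) * (int (p choose i) * int (q choose (N - i)))) =
    int m * (int q - int N + int m) * (x * y) + int N * (int p - 2 * int m) * (x * y)"
    using Suc c by (simp add: x_def y_def algebra_simps)
  \<comment> \<open>With \<open>q = 2 * N - p\<close> the polynomial
    \<open>m * (q - N + m) + N * (p - 2 * m)\<close> factors as
    \<open>(p - m) * (N - m)\<close>.\<close>
  also have "\<dots> = ((int p - int m) * x) * ((int N - int m) * y)"
    unfolding q by (simp add: algebra_simps)
  also have "\<dots> = int (Suc m) * (int q - int N + int (Suc m)) * (int (p choose Suc m) * int (q choose c))"
    unfolding P[symmetric] Q[symmetric] by (simp add: algebra_simps)
  finally show ?case unfolding c .
qed simp

text \<open>The hypotheses make \<open>m\<close> half of \<open>p\<close>, rounded up: truncated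
  subtraction kills the terms from \<open>m\<close> on and is exact below, so the telescoped sum
  stops at \<open>m\<close>.\<close>

lemma binomial_product_half_sum:
  assumes "p + q = 2 * N" "m \<le> N" "p \<le> 2 * m" "2 * m \<le> Suc p"
  shows "int (N * (\<Sum>i\<le>p. (p choose i) * ((p - 2 * i) * (q choose (N - i))))) =
    int m * (int q - int N + int m) * (int (p choose m) * int (q choose (N - m)))"
proof -
  have "(\<Sum>i\<le>p. (p choose i) * ((p - 2 * i) * (q choose (N - i)))) =
      (\<Sum>i<m. (p choose i) * ((p - 2 * i) * (q choose (N - i))))"
    using assms(3,4) by (intro sum.mono_neutral_cong) (auto simp: not_less)
  moreover have "int (\<Sum>i<m. (p choose i) * ((p - 2 * i) * (q choose (N - i)))) =
      (\<Sum>i<m. (int p - 2 * int i) * (int (p choose i) * int (q choose (N - i))))"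
    unfolding of_nat_sum using assms(4) by (intro sum.cong) (auto simp: of_nat_diff)
  ultimately show ?thesis
    unfolding of_nat_mult binomial_product_telescope[OF assms(1,2), symmetric] by simp
qed

text \<open>This is \<open>(2 * n + 1)! / (n!)^2\<close>, that is 1, 6, 30, 140 and so on. Its
  binomial factor is half of the central coefficient
  \<open>(2 * n + 2) choose (n + 1)\<close>.\<close>

definition half_central :: "nat \<Rightarrow> nat" where
  "half_central n = Suc n * (Suc (2 * n) choose n)"

lemma half_central_rec: "Suc n * half_central (Suc n) = 2 * (2 * n + 3) * half_central n"
proof -
  have 1: "Suc n * (Suc (2 * n + 2) choose Suc n) = Suc (2 * n + 2) * ((2 * n + 2) choose n)"
    by (rule Suc_times_binomial)
  have 2: "(n + 2) * ((2 * n + 2) choose n) = (2 * n + 2) * (Suc (2 * n) choose n)"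
    using binomial_absorb_comp[of "2 * n + 2" n] by simp
  have "half_central (Suc n) = (n + 2) * (Suc (2 * n + 2) choose Suc n)"
    by (simp add: half_central_def del: binomial_Suc_Suc)
  then have "Suc n * half_central (Suc n) = (n + 2) * (Suc n * (Suc (2 * n + 2) choose Suc n))"
    by (simp only: mult.left_commute)
  also have "\<dots> = Suc (2 * n + 2) * ((n + 2) * ((2 * n + 2) choose n))"
    unfolding 1 by (simp only: mult.left_commute)
  also have "\<dots> = 2 * (2 * n + 3) * half_central n"
    unfolding 2 half_central_def by (simp add: algebra_simps)
  finally show ?thesis .
qed

text \<open>Hence \<open>half_central n\<close> is the coefficient of \<open>x\<^sup>n\<close> in \<open>(1 - 4 x) powr (-3/2)\<close>.\<close>
lemma half_central_gbinomial: "real (half_central n) = (-4) ^ n * ((-3/2) gchoose n)"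
proof (induction n)
  case (Suc n)
  have "real (Suc n) * real (half_central (Suc n)) = 2 * (2 * real n + 3) * real (half_central n)"
    using arg_cong[OF half_central_rec[of n], of real] by (simp add: algebra_simps)
  also have "\<dots> = (-4) * (-4) ^ n * (((-3/2) - real n) * ((-3/2) gchoose n))"
    unfolding Suc by (simp add: algebra_simps)
  also have "((-3/2) - real n) * ((-3/2) gchoose n) = real (Suc n) * ((-3/2) gchoose (Suc n))"
    using gbinomial_mult_1[of "-3/2::real" n] by (simp add: algebra_simps)
  finally have "real (Suc n) * real (half_central (Suc n)) =
      real (Suc n) * ((-4) ^ Suc n * ((-3/2) gchoose (Suc n)))" by simp
  then show ?case unfolding mult_cancel_left by simp
qed (simp add: half_central_def)

text \<open>The square of \<open>(1 - 4 x) powr (-3/2)\<close> is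
  \<open>(1 - 4 x) powr (-3)\<close>. On coefficients this is Vandermonde's identity with upper
  arguments -3/2.\<close>

lemma half_central_convolution:
  "(\<Sum>i\<le>n. half_central i * half_central (n - i)) = 4 ^ n * ((n + 2) choose 2)"
proof -
  have "real (\<Sum>i\<le>n. half_central i * half_central (n - i)) =
      (\<Sum>i\<le>n. (-4) ^ n * (((-3/2) gchoose i) * ((-3/2) gchoose (n - i))))"
    by (auto simp: half_central_gbinomial power_add[symmetric] intro!: sum.cong)
  also have "\<dots> = (-4) ^ n * ((-3/2 + -3/2) gchoose n)"
    unfolding sum_distrib_left[symmetric] atMost_atLeast0 gbinomial_Vandermonde ..
  also have "(-3/2 + -3/2 :: real) gchoose n = (-1) ^ n * (real (n + 2) gchoose n)"
    using gbinomial_minus[of "3::real" n] by (simp add: add.commute)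
  also have "real (n + 2) gchoose n = real ((n + 2) choose n)" by (rule binomial_gbinomial[symmetric])
  also have "(n + 2) choose n = (n + 2) choose 2" using binomial_symmetric[of n "n + 2"] by simp
  also have "(-4 :: real) ^ n * ((-1) ^ n * real ((n + 2) choose 2)) = real (4 ^ n * ((n + 2) choose 2))"
    by (simp add: power_mult_distrib[symmetric] mult.assoc[symmetric])
  finally show ?thesis using of_nat_eq_iff by blast
qed

text \<open>With face sizes \<open>2 * a + 1\<close> and \<open>2 * c + 1\<close> the sum stops at
  \<open>m = Suc a\<close>, where the polynomial factor is \<open>Suc a * Suc c\<close>.\<close>

lemma annular_number_odd:
  "Suc (a + c) * annular_number (Suc (a + c)) (2 * a + 1) = half_central a * half_central c"
proof -
  have q: "2 * Suc (a + c) - (2 * a + 1) = 2 * c + 1" by simp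
  have s1: "Suc (2 * a) choose Suc a = Suc (2 * a) choose a"
    using binomial_symmetric[of a "Suc (2 * a)"] by simp
  have "int (Suc (a + c) * annular_number (Suc (a + c)) (2 * a + 1)) =
    int (Suc a) * (int (2 * c + 1) - int (Suc (a + c)) + int (Suc a)) *
      (int ((2 * a + 1) choose (Suc a)) * int ((2 * c + 1) choose (Suc (a + c) - Suc a)))"
    unfolding annular_number_def q
    by (rule binomial_product_half_sum) auto
  also have "\<dots> = int (half_central a * half_central c)"
    using s1 by (simp add: half_central_def algebra_simps del: binomial_Suc_Suc)
  finally show ?thesis using of_nat_eq_iff by blast
qed

text \<open>Again \<open>m = Suc a\<close>, but now both coefficients are central, each twice the
  one in \<open>half_central\<close>; hence the factor 4.\<close>

lemma annular_number_even:
  "(a + c + 2) * annular_number (a + c + 2) (2 * a + 2) = 4 * (half_central a * half_central c)"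
proof -
  have q: "2 * (a + c + 2) - (2 * a + 2) = 2 * c + 2" by simp
  have s: "Suc n * ((2 * n + 2) choose Suc n) = 2 * half_central n" for n
    using Suc_times_binomial[of n "Suc (2 * n)"] by (simp add: half_central_def)
  have "int ((a + c + 2) * annular_number (a + c + 2) (2 * a + 2)) =
    int (Suc a) * (int (2 * c + 2) - int (a + c + 2) + int (Suc a)) *
      (int ((2 * a + 2) choose (Suc a)) * int ((2 * c + 2) choose (a + c + 2 - Suc a)))"
    unfolding annular_number_def q by (rule binomial_product_half_sum) auto
  also have "\<dots> = int ((Suc a * ((2 * a + 2) choose Suc a)) * (Suc c * ((2 * c + 2) choose Suc c)))"
    by (simp add: algebra_simps del: binomial_Suc_Suc)
  also have "\<dots> = int (4 * (half_central a * half_central c))" unfolding s by simp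
  finally show ?thesis using of_nat_eq_iff by blast
qed

text \<open>Both face sizes have the same parity. The odd and the even ones give one convolution
  each, and multiplying by \<open>N\<close> clears the denominators.\<close>

lemma sum_annular_number:
  assumes "1 \<le> N"
  shows "(\<Sum>p\<in>{1..<2 * N}. annular_number N p) = N * 4 ^ (N - 1)"
proof -
  obtain n where N: "N = Suc n" using assms by (cases N) auto
  let ?h = half_central
  have odd: "N * (\<Sum>a\<le>n. annular_number N (2 * a + 1)) = 4 ^ n * ((n + 2) choose 2)"
  proof -
    have "N * annular_number N (2 * a + 1) = ?h a * ?h (n - a)" if "a \<le> n" for a
      using annular_number_odd[of a "n - a"] that by (simp add: N)
    then show ?thesis unfolding half_central_convolution[symmetric] sum_distrib_left by simp
  qed
  \<comment> \<open>The convolution has index \<open>n - 1\<close> here; the factor 4 restores the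
    power \<open>4 ^ n\<close>.\<close>
  have even: "N * (\<Sum>a<n. annular_number N (2 * a + 2)) = 4 ^ n * (Suc n choose 2)"
  proof (cases n)
    case (Suc m)
    have "N * annular_number N (2 * a + 2) = 4 * (?h a * ?h (m - a))" if "a < n" for a
      using annular_number_even[of a "m - a"] that by (simp add: N Suc)
    then have "N * (\<Sum>a<n. annular_number N (2 * a + 2)) = 4 * (\<Sum>a\<le>m. ?h a * ?h (m - a))"
      unfolding sum_distrib_left by (simp add: Suc lessThan_Suc_atMost)
    then show ?thesis unfolding half_central_convolution by (simp add: Suc)
  qed simp
  have "{1..<2 * N} = (\<lambda>a. 2 * a + 1) ` {..n} \<union> (\<lambda>a. 2 * a + 2) ` {..<n}"
  proof (intro equalityI subsetI)
    fix p assume p: "p \<in> {1..<2 * N}"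
    show "p \<in> (\<lambda>a. 2 * a + 1) ` {..n} \<union> (\<lambda>a. 2 * a + 2) ` {..<n}"
    proof (cases "even p")
      case True
      then have "p = 2 * (p div 2 - 1) + 2" "p div 2 - 1 < n" using p N by auto
      then show ?thesis by blast
    next
      case False
      then have "p = 2 * (p div 2) + 1" "p div 2 \<le> n" using p N by auto
      then show ?thesis by blast
    qed
  qed (auto simp: N)
  moreover have "(\<lambda>a. 2 * a + 1) ` {..n} \<inter> (\<lambda>a. 2 * a + 2) ` {..<n} = {}"
    by auto presburger
  ultimately have "(\<Sum>p\<in>{1..<2 * N}. annular_number N p) =
      (\<Sum>a\<le>n. annular_number N (2 * a + 1)) + (\<Sum>a<n. annular_number N (2 * a + 2))"
    by (simp add: sum.union_disjoint sum.reindex inj_on_def)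
  then have "N * (\<Sum>p\<in>{1..<2 * N}. annular_number N p) = 4 ^ n * (((n + 2) choose 2) + (Suc n choose 2))"
    using odd even by (simp add: distrib_left)
  \<comment> \<open>Two consecutive triangular numbers add up to a square.\<close>
  also have "((n + 2) choose 2) + (Suc n choose 2) = N * N"
    unfolding N by (induction n) (simp_all add: numeral_2_eq_2)
  finally have "N * (\<Sum>p\<in>{1..<2 * N}. annular_number N p) = N * (N * 4 ^ n)" by (simp only: ac_simps)
  then show ?thesis unfolding mult_cancel_left using N by auto
qed

section \<open>Gluing data\<close>

text \<open>Powers of the cycle rotate the list, so the orbit of its head visits every
  entry.\<close>

lemma cyclic_on_cycle_of_list:
  assumes "distinct cs" "cs \<noteq> []"
  shows "cyclic_on (cycle_of_list cs) (set cs)"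
proof (rule cyclic_on_singleI)
  let ?f = "cycle_of_list cs"
  show "hd cs \<in> set cs" using assms by simp
  have nth: "(?f ^^ n) (hd cs) = cs ! (n mod length cs)" for n
  proof -
    have "(?f ^^ n) (hd cs) = hd (map (?f ^^ n) cs)" using assms by (simp add: hd_map)
    also have "\<dots> = hd (rotate n cs)" using cyclic_rotation[OF assms(1)] by simp
    finally show ?thesis using assms by (simp add: hd_rotate_conv_nth)
  qed
  have "permutation ?f" by (rule permutation_of_cycle)
  then have "orbit ?f (hd cs) = range (\<lambda>n. cs ! (n mod length cs))"
    by (auto simp: orbit_altdef_permutation nth)
  also have "\<dots> = set cs"
  proof (intro equalityI subsetI)
    fix x assume "x \<in> set cs"
    then obtain i where "i < length cs" "x = cs ! i" by (metis in_set_conv_nth)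
    then have "x = cs ! (i mod length cs)" by simp
    then show "x \<in> range (\<lambda>n. cs ! (n mod length cs))" by blast
  qed (use assms(2) in auto)
  finally show "set cs = orbit ?f (hd cs)" ..
qed

lemma two_faces_face_perm:
  assumes "0 < m" "0 < n"
  shows "two_faces {1..m} {Suc m..m + n} (face_perm m n)"
proof -
  have s: "set [1..<Suc m] = {1..m}" "set [Suc m..<Suc (m + n)] = {Suc m..m + n}" by auto
  have dis: "{1..m} \<inter> {Suc m..m + n} = {}" by auto
  note p = cycle_permutes[of "[1..<Suc m]", unfolded s] cycle_permutes[of "[Suc m..<Suc (m + n)]", unfolded s]
  have c: "cyclic_on (cycle_of_list [1..<Suc m]) {1..m}"
    "cyclic_on (cycle_of_list [Suc m..<Suc (m + n)]) {Suc m..m + n}"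
    using cyclic_on_cycle_of_list[of "[1..<Suc m]"] cyclic_on_cycle_of_list[of "[Suc m..<Suc (m + n)]"]
      assms unfolding s by simp_all
  show ?thesis
    unfolding two_faces_def face_perm_def
  proof (intro conjI)
    show "cycle_of_list [1..<Suc m] \<circ> cycle_of_list [Suc m..<Suc (m + n)] permutes {1..m} \<union> {Suc m..m + n}"
      using p by (intro permutes_compose) (auto intro: permutes_subset)
    show "cyclic_on (cycle_of_list [1..<Suc m] \<circ> cycle_of_list [Suc m..<Suc (m + n)]) {1..m}"
      using p(2) c(1) dis by (rule permutes_comp_preserves_cyclic1) simp
    show "cyclic_on (cycle_of_list [1..<Suc m] \<circ> cycle_of_list [Suc m..<Suc (m + n)]) {Suc m..m + n}"
      using p(1) c(2) dis by (rule permutes_comp_preserves_cyclic2) simp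
  qed (rule dis)
qed

text \<open>Invariance is stated as an equivalence so that it passes to inverses of
  generators.\<close>

lemma generate_preserves:
  assumes "\<And>h x. h \<in> H \<Longrightarrow> h x \<in> A \<longleftrightarrow> x \<in> A" "H \<subseteq> carrier (sym_group n)"
    and "g \<in> generate (sym_group n) H"
  shows "g x \<in> A \<longleftrightarrow> x \<in> A"
  using assms(3)
proof (induction arbitrary: x)
  case (inv h)
  then have h: "h permutes {1..n}" using assms(2) sym_group_carrier by blast
  have "h (inv' h x) \<in> A \<longleftrightarrow> inv' h x \<in> A" using assms(1) inv by blast
  then show ?case using permutes_inverses(1)[OF h] h by (simp add: sym_group_carrier)
qed (use assms(1) in \<open>auto simp: sym_group_one sym_group_mult\<close>)

text \<open>Powers of \<open>\<tau>\<close> reach every corner of a face but never leave it, so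
  transitivity depends only on whether \<open>\<iota>\<close> crosses between the faces.\<close>

lemma transitive_iff_faces_glued:
  assumes tf: "two_faces A B \<tau>" and AB: "A \<union> B = {1..n}" and p: "pairing {1..n} \<iota>"
  shows "(\<forall>x\<in>{1..n}. \<forall>y\<in>{1..n}. \<exists>g\<in>generate (sym_group n) {\<iota>, \<tau>}. g x = y) \<longleftrightarrow>
    (\<exists>x\<in>A. \<iota> x \<in> B)"
proof
  have dis: "A \<inter> B = {}" using tf by (simp add: two_faces_def)
  have inv: "\<And>z. \<iota> (\<iota> z) = z" using p by (auto simp: pairing_def)
  obtain a b where ab: "a \<in> A" "b \<in> B" using tf by (auto simp: two_faces_def cyclic_on_def)
  assume "\<forall>x\<in>{1..n}. \<forall>y\<in>{1..n}. \<exists>g\<in>generate (sym_group n) {\<iota>, \<tau>}. g x = y"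
  then obtain g where g: "g \<in> generate (sym_group n) {\<iota>, \<tau>}" "g a = b" using ab AB by blast
  show "\<exists>x\<in>A. \<iota> x \<in> B"
  proof (rule ccontr)
    assume no: "\<not> ?thesis"
    have "\<iota> x \<in> A" if "x \<in> A" for x
      using that no pairing_in[OF p, of x] AB by blast
    then have "\<iota> x \<in> A \<longleftrightarrow> x \<in> A" for x using inv by metis
    then have 1: "h x \<in> A \<longleftrightarrow> x \<in> A" if "h \<in> {\<iota>, \<tau>}" for h x
      using that two_faces_in(1)[OF tf] by fastforce
    have "\<tau> permutes {1..n}" using tf unfolding two_faces_def AB by blast
    then have 2: "{\<iota>, \<tau>} \<subseteq> carrier (sym_group n)"
      using p by (simp add: sym_group_carrier pairing_def)
    have "g a \<in> A \<longleftrightarrow> a \<in> A" using 1 2 g(1) by (rule generate_preserves)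
    then show False using g ab dis by auto
  qed
next
  let ?G = "generate (sym_group n) {\<iota>, \<tau>}"
  have inv: "\<And>z. \<iota> (\<iota> z) = z" using p by (auto simp: pairing_def)
  assume "\<exists>x\<in>A. \<iota> x \<in> B"
  then obtain a where a: "a \<in> A" "\<iota> a \<in> B" by blast
  have comp: "g \<circ> h \<in> ?G" if "g \<in> ?G" "h \<in> ?G" for g h
    using generate.eng[OF that] by (simp add: sym_group_mult)
  have \<iota>: "\<iota> \<in> ?G" and \<tau>: "\<tau> \<in> ?G" by (auto intro: generate.incl)
  have face: "\<exists>g\<in>?G. g x = y" if C: "cyclic_on \<tau> C" "x \<in> C" "y \<in> C" for C x y
  proof -
    have "y \<in> orbit \<tau> x" using C by (auto simp: cyclic_on_alldef)
    then show ?thesis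
    proof induction
      case (step y)
      then obtain g where "g \<in> ?G" "g x = y" by blast
      then have "\<tau> \<circ> g \<in> ?G" "(\<tau> \<circ> g) x = \<tau> y" using comp[OF \<tau>] by auto
      then show ?case by blast
    qed (use \<tau> in blast)
  qed
  have cA: "cyclic_on \<tau> A" and cB: "cyclic_on \<tau> B" using tf by (auto simp: two_faces_def)
  have across: "\<exists>g\<in>?G. g x = y" if C: "cyclic_on \<tau> C" "cyclic_on \<tau> D" "x \<in> C" "y \<in> D" "c \<in> C" "\<iota> c \<in> D" for C D c x y
  proof -
    obtain g where g: "g \<in> ?G" "g x = c" using face[OF C(1) C(3) C(5)] by blast
    obtain h where h: "h \<in> ?G" "h (\<iota> c) = y" using face[OF C(2) C(6) C(4)] by blast
    have "(h \<circ> (\<iota> \<circ> g)) x = y" using g h by simp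
    moreover have "h \<circ> (\<iota> \<circ> g) \<in> ?G" using comp g h \<iota> by blast
    ultimately show ?thesis by blast
  qed
  show "\<forall>x\<in>{1..n}. \<forall>y\<in>{1..n}. \<exists>g\<in>?G. g x = y"
  proof (intro ballI)
    fix x y assume "x \<in> {1..n}" "y \<in> {1..n}"
    then consider "x \<in> A" "y \<in> A" | "x \<in> B" "y \<in> B" | "x \<in> A" "y \<in> B" | "x \<in> B" "y \<in> A"
      unfolding AB[symmetric] by blast
    then show "\<exists>g\<in>?G. g x = y"
    proof cases
      case 3
      then show ?thesis using across[OF cA cB _ _ a] by blast
    next
      case 4
      moreover have "\<iota> (\<iota> a) \<in> A" using a inv by simp
      ultimately show ?thesis using across[OF cB cA _ _ a(2)] by blast
    next
      case 1
      then show ?thesis by (rule face[OF cA])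
    next
      case 2
      then show ?thesis by (rule face[OF cB])
    qed
  qed
qed

lemma connected_genus0_iff_annular:
  assumes "0 < m1" "0 < m2" "m1 + m2 = 2 * N"
  shows "fpf_involution (2 * N) \<iota> \<and> connected_datum N (m1, m2, \<iota>) \<and> genus0_datum N (m1, m2, \<iota>) \<longleftrightarrow>
    annular {1..m1} {Suc m1..m1 + m2} (face_perm m1 m2) \<iota>"
proof -
  note tf = two_faces_face_perm[OF assms(1,2)]
  have un: "{1..m1} \<union> {Suc m1..m1 + m2} = {1..2 * N}" using assms by auto
  have "fpf_involution (2 * N) \<iota> \<longleftrightarrow> pairing {1..2 * N} \<iota>"
    by (auto simp: fpf_involution_def pairing_def fun_eq_iff)
  moreover have "genus0_datum N (m1, m2, \<iota>) \<longleftrightarrow>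
      2 * card (orbit (face_perm m1 m2 \<circ> \<iota>) ` {1..2 * N}) = card {1..2 * N}"
    by (auto simp: genus0_datum_def num_cycles_def)
  moreover have "connected_datum N (m1, m2, \<iota>) \<longleftrightarrow> (\<exists>x\<in>{1..m1}. \<iota> x \<in> {Suc m1..m1 + m2})"
    if "pairing {1..2 * N} \<iota>"
    unfolding connected_datum_def prod.case using transitive_iff_faces_glued[OF tf un that] .
  ultimately show ?thesis unfolding annular_def un by blast
qed

lemma eps0_2_eq_sum:
  "eps0_2 N = (\<Sum>m\<in>{1..<2 * N}.
    card {\<iota>. annular {1..m} {Suc m..2 * N} (face_perm m (2 * N - m)) \<iota>})"
proof -
  let ?X = "\<lambda>m. {\<iota>. annular {1..m} {Suc m..2 * N} (face_perm m (2 * N - m)) \<iota>}"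
  let ?f = "\<lambda>(m, \<iota>). (m, 2 * N - m, \<iota>)"
  have X: "?X m = {\<iota>. fpf_involution (2 * N) \<iota> \<and> connected_datum N (m, 2 * N - m, \<iota>) \<and>
      genus0_datum N (m, 2 * N - m, \<iota>)}" if "m \<in> {1..<2 * N}" for m
    using connected_genus0_iff_annular[of m "2 * N - m" N] that by auto
  have "{d \<in> gluing_data N. connected_datum N d \<and> genus0_datum N d} = ?f ` (SIGMA m:{1..<2 * N}. ?X m)"
  proof (intro equalityI subsetI)
    fix d assume d: "d \<in> {d \<in> gluing_data N. connected_datum N d \<and> genus0_datum N d}"
    obtain m1 m2 \<iota> where d': "d = (m1, m2, \<iota>)" by (cases d)
    then have m: "m1 \<in> {1..<2 * N}" "m2 = 2 * N - m1" using d by (auto simp: gluing_data_def)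
    then have "(m1, \<iota>) \<in> (SIGMA m:{1..<2 * N}. ?X m)"
      using d d' X by (auto simp: gluing_data_def)
    moreover have "d = ?f (m1, \<iota>)" using d' m by simp
    ultimately show "d \<in> ?f ` (SIGMA m:{1..<2 * N}. ?X m)" by (rule rev_image_eqI)
  next
    fix d assume "d \<in> ?f ` (SIGMA m:{1..<2 * N}. ?X m)"
    then obtain m \<iota> where "m \<in> {1..<2 * N}" "\<iota> \<in> ?X m" "d = (m, 2 * N - m, \<iota>)" by auto
    then show "d \<in> {d \<in> gluing_data N. connected_datum N d \<and> genus0_datum N d}"
      using X by (auto simp: gluing_data_def)
  qed
  moreover have "inj_on ?f (SIGMA m:{1..<2 * N}. ?X m)" by (auto simp: inj_on_def)
  ultimately have "eps0_2 N = card (SIGMA m:{1..<2 * N}. ?X m)"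
    unfolding eps0_2_def by (simp only: card_image)
  also have "\<dots> = (\<Sum>m\<in>{1..<2 * N}. card (?X m))"
  proof (rule card_SigmaI)
    show "\<forall>m\<in>{1..<2 * N}. finite (?X m)"
    proof
      fix m assume "m \<in> {1..<2 * N}"
      then show "finite (?X m)"
        using finite_annular[OF two_faces_face_perm[of m "2 * N - m"]] by simp
    qed
  qed simp
  finally show ?thesis .
qed

theorem theorem2:
  fixes N :: nat
  assumes "N \<ge> 1"
  shows "eps0_2 N = N * 4 ^ (N - 1)"
proof -
  have "card {\<iota>. annular {1..m} {Suc m..2 * N} (face_perm m (2 * N - m)) \<iota>} = annular_number N m"
    if "m \<in> {1..<2 * N}" for m
    using card_annular_eq_annular_number[OF two_faces_face_perm[of m "2 * N - m"], of N] that by simp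
  then show ?thesis unfolding eps0_2_eq_sum using sum_annular_number[OF assms] by simp
qed

end
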